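(* Let $f,g\in C(\mathbb{A}/\mathbb{Q},S^1)$. Then $f$ and $g$ are homotopic (as continuous maps $\mathbb{A}/\mathbb{Q}\to S^1$) if and only if $\#f=\#g$.
   Context: $\mathbb{A}=\mathbb{R}\times\mathbb{A}_f$ is the adele ring of $\mathbb{Q}$ with the restricted product topology, elements written $\{x_\infty,x_f\}$; $\mathbb{Q}$ is embedded diagonally in $\mathbb{A}$, and elements of $C(\mathbb{A}/\mathbb{Q},S^1)$ are identified with continuous $\mathbb{Q}$-periodic functions $\mathbb{A}\to S^1$. A function $h\in C(\mathbb{R},S^1)$ is pre-periodic if for every $\varepsilon>0$ there exists a positive integer $N$ such that $|h(x+kN)-h(x)|<\varepsilon$ for all $k\in\mathbb{Z}$, $x\in\mathbb{R}$; its generalized winding number is $\#h=\lim_{x\to+\infty}\frac{\tilde h(x)-\tilde h(-x)}{2x}\in\mathbb{Q}$, where $\tilde h\in C(\mathbb{R},\mathbb{R})$ is any lift, $e^{2\pi i\tilde h}=h$ (the limit exists and is independent of the lift). For $g\in C(\mathbb{A}/\mathbb{Q},S^1)$, the function $g_{0_f}(x_\infty):=g(\{x_\infty,0_f\})$ on $\mathbb{R}$, with $0_f$ the zero of $\mathbb{A}_f$, is pre-periodic, and $\#g:=\#g_{0_f}$. *)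

theory Defs
  imports "HOL-Analysis.Analysis" "HOL-Algebra.QuotRing"
begin

section \<open>The field of \<open>p\<close>-adic numbers\<close>

text \<open>
  For a prime \<open>p\<close>, \<open>\<rat>\<^sub>p\<close> is the completion of \<open>\<rat>\<close> for the \<open>p\<close>-adic absolute value: the ring of
  \<open>p\<close>-adic Cauchy sequences modulo the ideal of \<open>p\<close>-adic null sequences.
\<close>

definition padic_abs :: "nat \<Rightarrow> rat \<Rightarrow> real" where
  "padic_abs p q =
     (if q = 0 then 0
      else real p ^ multiplicity (int p) (snd (quotient_of q))
         / real p ^ multiplicity (int p) (fst (quotient_of q)))"

definition padic_Cauchy :: "nat \<Rightarrow> (nat \<Rightarrow> rat) \<Rightarrow> bool" where
  "padic_Cauchy p a \<longleftrightarrow> (\<forall>e>0. \<exists>N. \<forall>m\<ge>N. \<forall>n\<ge>N. padic_abs p (a m - a n) < e)"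

definition padic_Cauchy_ring :: "nat \<Rightarrow> (nat \<Rightarrow> rat) ring" where
  "padic_Cauchy_ring p =
     \<lparr>carrier = {a. padic_Cauchy p a}, mult = (\<lambda>a b n. a n * b n), one = (\<lambda>n. 1),
      zero = (\<lambda>n. 0), add = (\<lambda>a b n. a n + b n)\<rparr>"

definition padic_null :: "nat \<Rightarrow> (nat \<Rightarrow> rat) set" where
  "padic_null p = {a. (\<lambda>n. padic_abs p (a n)) \<longlonglongrightarrow> 0}"

lemma padic_abs_quotient:
  assumes p: "prime p" and "a \<noteq> 0" "b \<noteq> 0"
  shows "padic_abs p (of_int a / of_int b)
         = real p ^ multiplicity (int p) b / real p ^ multiplicity (int p) a"
proof -
  define n d where "n = fst (quotient_of (of_int a / of_int b))"
    and "d = snd (quotient_of (of_int a / of_int b))"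
  have q: "quotient_of (of_int a / of_int b) = (n, d)" by (simp add: n_def d_def)
  have d: "d > 0" using quotient_of_denom_pos[OF q] .
  have eq: "(of_int a / of_int b :: rat) = of_int n / of_int d" using quotient_of_div[OF q] .
  have n: "n \<noteq> 0" using eq assms d by auto
  have "(of_int (a * d) :: rat) = of_int (n * b)" using eq assms d by (simp add: field_simps)
  then have ad: "a * d = n * b" by linarith
  have pe: "prime_elem (int p)" using p by (simp add: prime_imp_prime_elem)
  have "multiplicity (int p) a + multiplicity (int p) d
        = multiplicity (int p) n + multiplicity (int p) b"
    using ad n d assms prime_elem_multiplicity_mult_distrib[OF pe] by (metis less_irrefl)
  then have "real p ^ multiplicity (int p) a * real p ^ multiplicity (int p) d
        = real p ^ multiplicity (int p) n * real p ^ multiplicity (int p) b"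
    by (metis power_add)
  then show ?thesis
    using assms p prime_gt_0_nat[OF p]
    by (simp add: padic_abs_def n_def[symmetric] d_def[symmetric] field_simps)
qed

lemma padic_abs_0 [simp]: "padic_abs p 0 = 0"
  by (simp add: padic_abs_def)

lemma padic_abs_nonneg [simp]: "0 \<le> padic_abs p x"
  by (simp add: padic_abs_def)

lemma padic_abs_eq_0: "prime p \<Longrightarrow> padic_abs p x = 0 \<longleftrightarrow> x = 0"
  using prime_gt_0_nat[of p] by (auto simp: padic_abs_def)

lemma rat_quotient: obtains a b :: int where "b \<noteq> 0" "(x::rat) = of_int a / of_int b"
proof
  show "snd (quotient_of x) \<noteq> 0" using quotient_of_denom_pos'[of x] by linarith
  show "x = of_int (fst (quotient_of x)) / of_int (snd (quotient_of x))"
    by (rule quotient_of_div) simp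
qed

lemma padic_abs_1 [simp]: "padic_abs p 1 = 1"
  by (simp add: padic_abs_def)

lemma padic_abs_mult:
  assumes p: "prime p"
  shows "padic_abs p (x * y) = padic_abs p x * padic_abs p y"
proof (cases "x = 0 \<or> y = 0")
  case False
  obtain a b where x: "b \<noteq> 0" "x = of_int a / of_int b" by (rule rat_quotient)
  obtain c d where y: "d \<noteq> 0" "y = of_int c / of_int d" by (rule rat_quotient)
  have nz: "a \<noteq> 0" "c \<noteq> 0" using False x y by auto
  have xy: "x * y = of_int (a * c) / of_int (b * d)" using x y by simp
  have pe: "prime_elem (int p)" using p by (simp add: prime_imp_prime_elem)
  show ?thesis
    unfolding xy unfolding x(2) y(2) using nz x(1) y(1)
    by (subst (1 2 3) padic_abs_quotient[OF p])
       (simp_all add: prime_elem_multiplicity_mult_distrib[OF pe] power_add)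
qed auto

lemma padic_abs_minus [simp]: "padic_abs p (- x) = padic_abs p x"
  by (cases "quotient_of x") (simp add: padic_abs_def rat_uminus_code Let_def
       multiplicity_times_unit_right[of "- 1 :: int", simplified])

lemma padic_abs_add_le_max:
  assumes p: "prime p"
  shows "padic_abs p (x + y) \<le> max (padic_abs p x) (padic_abs p y)"
proof (cases "x = 0 \<or> y = 0 \<or> x + y = 0")
  case True
  then show ?thesis by (elim disjE) (simp_all add: le_max_iff_disj)
next
  case False
  obtain a b where x: "b \<noteq> 0" "x = of_int a / of_int b" by (rule rat_quotient)
  obtain c d where y: "d \<noteq> 0" "y = of_int c / of_int d" by (rule rat_quotient)
  define u v w where "u = a * d" and "v = c * b" and "w = b * d"
  have eqs: "x = of_int u / of_int w" "y = of_int v / of_int w" "x + y = of_int (u + v) / of_int w"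
    using x y by (simp_all add: u_def v_def w_def field_simps)
  have w: "w \<noteq> 0" using x y by (simp add: w_def)
  have nz: "u \<noteq> 0" "v \<noteq> 0" "u + v \<noteq> 0" using False eqs by auto
  let ?m = "\<lambda>k. multiplicity (int p) k"
  have nu: "\<not> is_unit (int p)" using p by (metis not_prime_unit prime_nat_int_transfer)
  have "int p ^ min (?m u) (?m v) dvd u + v"
    by (intro dvd_add) (simp_all add: multiplicity_dvd')
  then have "min (?m u) (?m v) \<le> ?m (u + v)"
    using nz nu by (metis power_dvd_iff_le_multiplicity)
  then have "?m u \<le> ?m (u + v) \<or> ?m v \<le> ?m (u + v)" by linarith
  moreover have p1: "1 \<le> real p" using prime_ge_1_nat[OF p] by simp
  ultimately have "real p ^ ?m u \<le> real p ^ ?m (u + v) \<or> real p ^ ?m v \<le> real p ^ ?m (u + v)"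
    using power_increasing by blast
  moreover have pos: "0 < real p ^ k" for k using p1 by simp
  ultimately have "real p ^ ?m w / real p ^ ?m (u + v) \<le> real p ^ ?m w / real p ^ ?m u
      \<or> real p ^ ?m w / real p ^ ?m (u + v) \<le> real p ^ ?m w / real p ^ ?m v"
    using pos by (meson divide_left_mono less_imp_le mult_pos_pos)
  then show ?thesis
    unfolding eqs(3) unfolding eqs(1,2) using nz w
    by (simp add: padic_abs_quotient[OF p] le_max_iff_disj del: of_int_add)
qed

lemma padic_abs_triangle: "prime p \<Longrightarrow> padic_abs p (x + y) \<le> padic_abs p x + padic_abs p y"
  using padic_abs_add_le_max[of p x y] padic_abs_nonneg[of p x] padic_abs_nonneg[of p y]
  by linarith

lemma padic_abs_diff_commute: "padic_abs p (x - y) = padic_abs p (y - x)"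
  by (metis minus_diff_eq padic_abs_minus)

lemma padic_Cauchy_const: "padic_Cauchy p (\<lambda>n. q)"
  by (simp add: padic_Cauchy_def)

lemma padic_Cauchy_add:
  assumes p: "prime p" and a: "padic_Cauchy p a" and b: "padic_Cauchy p b"
  shows "padic_Cauchy p (\<lambda>n. a n + b n)"
  unfolding padic_Cauchy_def
proof (intro allI impI)
  fix e :: real assume e: "e > 0"
  obtain M where M: "\<And>m n. m \<ge> M \<Longrightarrow> n \<ge> M \<Longrightarrow> padic_abs p (a m - a n) < e"
    using a e unfolding padic_Cauchy_def by blast
  obtain N where N: "\<And>m n. m \<ge> N \<Longrightarrow> n \<ge> N \<Longrightarrow> padic_abs p (b m - b n) < e"
    using b e unfolding padic_Cauchy_def by blast
  have "padic_abs p (a m + b m - (a n + b n)) < e" if "m \<ge> max M N" "n \<ge> max M N" for m n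
    using padic_abs_add_le_max[OF p, of "a m - a n" "b m - b n"] M[of m n] N[of m n] that
    by (simp add: algebra_simps)
  then show "\<exists>N. \<forall>m\<ge>N. \<forall>n\<ge>N. padic_abs p (a m + b m - (a n + b n)) < e" by blast
qed

lemma padic_Cauchy_uminus: "padic_Cauchy p a \<Longrightarrow> padic_Cauchy p (\<lambda>n. - a n)"
  unfolding padic_Cauchy_def by (simp add: padic_abs_diff_commute)

lemma padic_Cauchy_bounded:
  assumes p: "prime p" and a: "padic_Cauchy p a"
  obtains B where "B > 0" "\<And>n. padic_abs p (a n) \<le> B"
proof -
  obtain N where N: "\<And>m n. m \<ge> N \<Longrightarrow> n \<ge> N \<Longrightarrow> padic_abs p (a m - a n) < 1"
    using a unfolding padic_Cauchy_def by (meson zero_less_one)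
  define B where "B = (\<Sum>k\<le>N. padic_abs p (a k)) + 1"
  have le: "padic_abs p (a k) \<le> B - 1" if "k \<le> N" for k
    unfolding B_def using that by (simp add: member_le_sum[of k "{..N}" "\<lambda>k. padic_abs p (a k)"])
  have "padic_abs p (a n) \<le> B" for n
  proof (cases "n \<le> N")
    case True then show ?thesis using le[of n] by linarith
  next
    case False
    then show ?thesis
      using padic_abs_triangle[OF p, of "a n - a N" "a N"] N[of n N] le[of N] by simp
  qed
  moreover have "B > 0"
    unfolding B_def by (smt (verit) padic_abs_nonneg sum_nonneg)
  ultimately show ?thesis using that by blast
qed

lemma padic_Cauchy_mult:
  assumes p: "prime p" and a: "padic_Cauchy p a" and b: "padic_Cauchy p b"
  shows "padic_Cauchy p (\<lambda>n. a n * b n)"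
  unfolding padic_Cauchy_def
proof (intro allI impI)
  fix e :: real assume e: "e > 0"
  obtain A where A: "A > 0" "\<And>n. padic_abs p (a n) \<le> A" using padic_Cauchy_bounded[OF p a] by blast
  obtain B where B: "B > 0" "\<And>n. padic_abs p (b n) \<le> B" using padic_Cauchy_bounded[OF p b] by blast
  obtain M where M: "\<And>m n. m \<ge> M \<Longrightarrow> n \<ge> M \<Longrightarrow> padic_abs p (a m - a n) < e / B"
    using a e B unfolding padic_Cauchy_def by (meson divide_pos_pos)
  obtain N where N: "\<And>m n. m \<ge> N \<Longrightarrow> n \<ge> N \<Longrightarrow> padic_abs p (b m - b n) < e / A"
    using b e A unfolding padic_Cauchy_def by (meson divide_pos_pos)
  have "padic_abs p (a m * b m - a n * b n) < e" if "m \<ge> max M N" "n \<ge> max M N" for m n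
  proof -
    have "padic_abs p (a m * (b m - b n)) \<le> A * padic_abs p (b m - b n)"
      using A by (simp add: padic_abs_mult[OF p] mult_right_mono)
    also have "\<dots> < e"
      using N[of m n] that A by (simp add: field_simps)
    finally have 1: "padic_abs p (a m * (b m - b n)) < e" .
    have "padic_abs p ((a m - a n) * b n) \<le> padic_abs p (a m - a n) * B"
      using B by (simp add: padic_abs_mult[OF p] mult_left_mono)
    also have "\<dots> < e"
      using M[of m n] that B by (simp add: field_simps)
    finally have 2: "padic_abs p ((a m - a n) * b n) < e" .
    have "a m * b m - a n * b n = a m * (b m - b n) + (a m - a n) * b n"
      by (simp add: algebra_simps)
    then show ?thesis
      using padic_abs_add_le_max[OF p, of "a m * (b m - b n)" "(a m - a n) * b n"] 1 2 by simp
  qed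
  then show "\<exists>N. \<forall>m\<ge>N. \<forall>n\<ge>N. padic_abs p (a m * b m - a n * b n) < e" by blast
qed

lemma cring_padic_Cauchy_ring:
  assumes p: "prime p"
  shows "cring (padic_Cauchy_ring p)"
proof (rule cringI)
  show "abelian_group (padic_Cauchy_ring p)"
  proof (rule abelian_groupI)
    fix a assume "a \<in> carrier (padic_Cauchy_ring p)"
    then show "\<exists>b\<in>carrier (padic_Cauchy_ring p).
        b \<oplus>\<^bsub>padic_Cauchy_ring p\<^esub> a = \<zero>\<^bsub>padic_Cauchy_ring p\<^esub>"
      by (intro bexI[of _ "\<lambda>n. - a n"])
         (auto simp: padic_Cauchy_ring_def padic_Cauchy_uminus)
  qed (auto simp: padic_Cauchy_ring_def padic_Cauchy_add[OF p] padic_Cauchy_const algebra_simps)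
  show "comm_monoid (padic_Cauchy_ring p)"
    by (rule comm_monoidI)
       (auto simp: padic_Cauchy_ring_def padic_Cauchy_mult[OF p] padic_Cauchy_const algebra_simps)
qed (auto simp: padic_Cauchy_ring_def algebra_simps)

lemma padic_null_Cauchy:
  assumes p: "prime p" and a: "a \<in> padic_null p"
  shows "padic_Cauchy p a"
  unfolding padic_Cauchy_def
proof (intro allI impI)
  fix e :: real assume e: "e > 0"
  have "(\<lambda>n. padic_abs p (a n)) \<longlonglongrightarrow> 0" using a by (simp add: padic_null_def)
  then obtain N where N: "\<And>n. n \<ge> N \<Longrightarrow> padic_abs p (a n) < e"
    using LIMSEQ_D[OF _ e] by fastforce
  have "padic_abs p (a m - a n) < e" if "m \<ge> N" "n \<ge> N" for m n
    using padic_abs_add_le_max[OF p, of "a m" "- a n"] N that by (smt (verit) add_uminus_conv_diff padic_abs_minus)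
  then show "\<exists>N. \<forall>m\<ge>N. \<forall>n\<ge>N. padic_abs p (a m - a n) < e" by blast
qed

lemma padic_null_uminus: "a \<in> padic_null p \<Longrightarrow> (\<lambda>n. - a n) \<in> padic_null p"
  by (simp add: padic_null_def)

lemma padic_null_add:
  assumes p: "prime p" and "a \<in> padic_null p" "b \<in> padic_null p"
  shows "(\<lambda>n. a n + b n) \<in> padic_null p"
  unfolding padic_null_def mem_Collect_eq
proof (rule tendsto_sandwich[of "\<lambda>_. 0" _ _ "\<lambda>n. padic_abs p (a n) + padic_abs p (b n)"])
  show "(\<lambda>n. padic_abs p (a n) + padic_abs p (b n)) \<longlonglongrightarrow> 0"
    using assms tendsto_add[of "\<lambda>n. padic_abs p (a n)" 0 _ "\<lambda>n. padic_abs p (b n)" 0]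
    by (simp add: padic_null_def)
qed (auto simp: padic_abs_triangle[OF p])

lemma padic_null_mult:
  assumes p: "prime p" and a: "a \<in> padic_null p" and b: "padic_Cauchy p b"
  shows "(\<lambda>n. a n * b n) \<in> padic_null p"
  unfolding padic_null_def mem_Collect_eq
proof -
  obtain B where B: "B > 0" "\<And>n. padic_abs p (b n) \<le> B" using padic_Cauchy_bounded[OF p b] by blast
  show "(\<lambda>n. padic_abs p (a n * b n)) \<longlonglongrightarrow> 0"
  proof (rule tendsto_sandwich[of "\<lambda>_. 0" _ _ "\<lambda>n. padic_abs p (a n) * B"])
    show "(\<lambda>n. padic_abs p (a n) * B) \<longlonglongrightarrow> 0"
      using a by (auto simp: padic_null_def intro: tendsto_mult_left_zero)
  qed (auto simp: padic_abs_mult[OF p] B mult_left_mono)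
qed

lemma padic_Cauchy_ring_a_inv:
  assumes p: "prime p" and a: "padic_Cauchy p a"
  shows "\<ominus>\<^bsub>padic_Cauchy_ring p\<^esub> a = (\<lambda>n. - a n)"
proof -
  interpret cring "padic_Cauchy_ring p" by (rule cring_padic_Cauchy_ring[OF p])
  show ?thesis
    by (rule minus_equality) (use a in \<open>auto simp: padic_Cauchy_ring_def padic_Cauchy_uminus\<close>)
qed

lemma ideal_padic_null:
  assumes p: "prime p"
  shows "ideal (padic_null p) (padic_Cauchy_ring p)"
proof -
  interpret cring "padic_Cauchy_ring p" by (rule cring_padic_Cauchy_ring[OF p])
  show ?thesis
  proof (rule idealI)
    show "ring (padic_Cauchy_ring p)" by (rule ring_axioms)
    show "subgroup (padic_null p) (add_monoid (padic_Cauchy_ring p))"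
    proof (rule add.subgroupI)
      show "padic_null p \<subseteq> carrier (padic_Cauchy_ring p)"
        using padic_null_Cauchy[OF p] by (auto simp: padic_Cauchy_ring_def)
      show "padic_null p \<noteq> {}"
        by (auto simp: padic_null_def intro!: exI[of _ "\<lambda>n. 0"])
      show "\<ominus>\<^bsub>padic_Cauchy_ring p\<^esub> a \<in> padic_null p" if "a \<in> padic_null p" for a
        using that padic_Cauchy_ring_a_inv[OF p] padic_null_Cauchy[OF p] padic_null_uminus by simp
      show "a \<oplus>\<^bsub>padic_Cauchy_ring p\<^esub> b \<in> padic_null p" if "a \<in> padic_null p" "b \<in> padic_null p" for a b
        using that padic_null_add[OF p] by (simp add: padic_Cauchy_ring_def)
    qed
    show "x \<otimes>\<^bsub>padic_Cauchy_ring p\<^esub> a \<in> padic_null p"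
      if "a \<in> padic_null p" "x \<in> carrier (padic_Cauchy_ring p)" for a x
      using padic_null_mult[OF p, of a x] that by (simp add: padic_Cauchy_ring_def mult.commute)
    show "a \<otimes>\<^bsub>padic_Cauchy_ring p\<^esub> x \<in> padic_null p"
      if "a \<in> padic_null p" "x \<in> carrier (padic_Cauchy_ring p)" for a x
      using padic_null_mult[OF p, of a x] that by (simp add: padic_Cauchy_ring_def)
  qed
qed

type_synonym padic = "(nat \<Rightarrow> rat) set"

definition padic_ring :: "nat \<Rightarrow> padic ring" where
  "padic_ring p = padic_Cauchy_ring p Quot padic_null p"

lemma cring_padic_ring: "prime p \<Longrightarrow> cring (padic_ring p)"
  unfolding padic_ring_def
  by (rule ideal.quotient_is_cring[OF ideal_padic_null cring_padic_Cauchy_ring])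

definition padic_class :: "nat \<Rightarrow> (nat \<Rightarrow> rat) \<Rightarrow> padic" where
  "padic_class p a = padic_null p +>\<^bsub>padic_Cauchy_ring p\<^esub> a"

lemma padic_class_mem:
  assumes "b \<in> padic_class p a"
  shows "(\<lambda>n. b n - a n) \<in> padic_null p"
  using assms by (auto simp: padic_class_def a_r_coset_def' padic_Cauchy_ring_def)

lemma padic_class_self: "a \<in> padic_class p a"
  by (auto simp: padic_class_def a_r_coset_def' padic_Cauchy_ring_def padic_null_def
      intro!: exI[of _ "\<lambda>n. 0"])

lemma padic_class_eq:
  assumes p: "prime p" and "(\<lambda>n. b n - a n) \<in> padic_null p"
  shows "padic_class p a = padic_class p b"
proof -
  have "(\<lambda>n. c n + a n) \<in> padic_class p b" if "c \<in> padic_null p"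
    "(\<lambda>n. b n - a n) \<in> padic_null p" for a b c
  proof -
    have "(\<lambda>n. c n + - (b n - a n)) \<in> padic_null p"
      using that by (intro padic_null_add[OF p] padic_null_uminus)
    then show ?thesis
      by (auto simp: padic_class_def a_r_coset_def' padic_Cauchy_ring_def
          intro!: bexI[of _ "\<lambda>n. c n + - (b n - a n)"])
  qed
  then have sub: "padic_class p a \<subseteq> padic_class p b" if "(\<lambda>n. b n - a n) \<in> padic_null p" for a b
    using that by (auto simp: padic_class_def[of p a] a_r_coset_def' padic_Cauchy_ring_def)
  have "(\<lambda>n. a n - b n) \<in> padic_null p"
    using padic_null_uminus[OF assms(2)] by simp
  then show ?thesis using sub assms by blast
qed

lemma carrier_padic_ring: "carrier (padic_ring p) = padic_class p ` {a. padic_Cauchy p a}"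
  by (auto simp: padic_ring_def FactRing_def A_RCOSETS_def' padic_class_def padic_Cauchy_ring_def)

lemma padic_zero:
  assumes p: "prime p"
  shows "\<zero>\<^bsub>padic_ring p\<^esub> = padic_class p (\<lambda>n. 0)"
proof -
  interpret ideal "padic_null p" "padic_Cauchy_ring p" by (rule ideal_padic_null[OF p])
  show ?thesis
    using a_rcos_zero[OF ideal_axioms, of "\<lambda>n. 0"] 
    by (auto simp: padic_ring_def FactRing_def padic_class_def a_r_coset_def' padic_Cauchy_ring_def)
qed

lemma padic_one: "\<one>\<^bsub>padic_ring p\<^esub> = padic_class p (\<lambda>n. 1)"
  by (simp add: padic_ring_def FactRing_def padic_class_def padic_Cauchy_ring_def)

lemma padic_add:
  assumes p: "prime p" and "padic_Cauchy p a" "padic_Cauchy p b"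
  shows "padic_class p a \<oplus>\<^bsub>padic_ring p\<^esub> padic_class p b = padic_class p (\<lambda>n. a n + b n)"
proof -
  interpret ideal "padic_null p" "padic_Cauchy_ring p" by (rule ideal_padic_null[OF p])
  show ?thesis
    using a_rcos_sum[of a b] assms
    by (simp add: padic_ring_def FactRing_def padic_class_def padic_Cauchy_ring_def)
qed

lemma padic_mult:
  assumes p: "prime p" and "padic_Cauchy p a" "padic_Cauchy p b"
  shows "padic_class p a \<otimes>\<^bsub>padic_ring p\<^esub> padic_class p b = padic_class p (\<lambda>n. a n * b n)"
proof -
  interpret ideal "padic_null p" "padic_Cauchy_ring p" by (rule ideal_padic_null[OF p])
  show ?thesis
    using rcoset_mult_add[of a b] assms
    by (simp add: padic_ring_def FactRing_def padic_class_def padic_Cauchy_ring_def)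
qed

definition padic_of_rat :: "nat \<Rightarrow> rat \<Rightarrow> padic" where
  "padic_of_rat p q = padic_class p (\<lambda>n. q)"

text \<open>
  The limit does not depend on the representatives. The value off the carrier is irrelevant, but
  \<^locale>\<open>Metric_space\<close> asks for symmetry and nonnegativity of the distance on the whole type.
\<close>

definition padic_dist :: "nat \<Rightarrow> padic \<Rightarrow> padic \<Rightarrow> real" where
  "padic_dist p X Y =
     (if X \<in> carrier (padic_ring p) \<and> Y \<in> carrier (padic_ring p)
      then THE r. \<forall>a\<in>X. \<forall>b\<in>Y. (\<lambda>n. padic_abs p (a n - b n)) \<longlonglongrightarrow> r
      else 0)"

lemma padic_abs_convergent:
  assumes p: "prime p" and a: "padic_Cauchy p a"
  shows "convergent (\<lambda>n. padic_abs p (a n))"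
  unfolding Cauchy_convergent_iff[symmetric]
proof (rule CauchyI)
  fix e :: real assume "e > 0"
  then obtain N where N: "\<And>m n. m \<ge> N \<Longrightarrow> n \<ge> N \<Longrightarrow> padic_abs p (a m - a n) < e"
    using a unfolding padic_Cauchy_def by blast
  have "norm (padic_abs p (a m) - padic_abs p (a n)) < e" if "m \<ge> N" "n \<ge> N" for m n
    using padic_abs_triangle[OF p, of "a m - a n" "a n"] padic_abs_triangle[OF p, of "a n - a m" "a m"]
      N[of m n] N[of n m] that by (simp add: abs_less_iff)
  then show "\<exists>M. \<forall>m\<ge>M. \<forall>n\<ge>M. norm (padic_abs p (a m) - padic_abs p (a n)) < e" by blast
qed

lemma padic_abs_null_shift:
  assumes p: "prime p" and "(\<lambda>n. b n - a n) \<in> padic_null p"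
    and lim: "(\<lambda>n. padic_abs p (a n)) \<longlonglongrightarrow> r"
  shows "(\<lambda>n. padic_abs p (b n)) \<longlonglongrightarrow> r"
proof -
  have 0: "(\<lambda>n. padic_abs p (b n - a n)) \<longlonglongrightarrow> 0" using assms by (simp add: padic_null_def)
  have "\<bar>padic_abs p (b n) - padic_abs p (a n)\<bar> \<le> padic_abs p (b n - a n)" for n
    using padic_abs_triangle[OF p, of "b n - a n" "a n"] padic_abs_triangle[OF p, of "a n - b n" "b n"]
      padic_abs_diff_commute[of p "a n" "b n"] by simp
  then have "(\<lambda>n. padic_abs p (b n) - padic_abs p (a n)) \<longlonglongrightarrow> 0"
    by (intro tendsto_rabs_zero_cancel[OF tendsto_sandwich[OF _ _ tendsto_const 0]]) auto
  from tendsto_add[OF this lim] show ?thesis by simp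
qed

lemma padic_dist_tendsto:
  assumes p: "prime p" and a: "padic_Cauchy p a" and b: "padic_Cauchy p b"
  shows "(\<lambda>n. padic_abs p (a n - b n)) \<longlonglongrightarrow> padic_dist p (padic_class p a) (padic_class p b)"
proof -
  have "padic_Cauchy p (\<lambda>n. a n - b n)"
    using padic_Cauchy_add[OF p a padic_Cauchy_uminus[OF b]] by simp
  then obtain r where r: "(\<lambda>n. padic_abs p (a n - b n)) \<longlonglongrightarrow> r"
    using padic_abs_convergent[OF p] by (auto simp: convergent_def)
  have all: "(\<lambda>n. padic_abs p (c n - d n)) \<longlonglongrightarrow> r"
    if "c \<in> padic_class p a" "d \<in> padic_class p b" for c d
  proof (rule padic_abs_null_shift[OF p _ r])
    show "(\<lambda>n. c n - d n - (a n - b n)) \<in> padic_null p"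
      using padic_null_add[OF p padic_class_mem[OF that(1)] padic_null_uminus[OF padic_class_mem[OF that(2)]]]
      by (simp add: algebra_simps)
  qed
  have "(THE r. \<forall>c\<in>padic_class p a. \<forall>d\<in>padic_class p b. (\<lambda>n. padic_abs p (c n - d n)) \<longlonglongrightarrow> r) = r"
    using all padic_class_self[of a p] padic_class_self[of b p] r LIMSEQ_unique
    by (intro the_equality) blast+
  then have "padic_dist p (padic_class p a) (padic_class p b) = r"
    using a b by (simp add: padic_dist_def carrier_padic_ring)
  then show ?thesis using r by simp
qed

lemma Metric_space_padic:
  assumes p: "prime p"
  shows "Metric_space (carrier (padic_ring p)) (padic_dist p)"
proof
  fix X Y
  show "0 \<le> padic_dist p X Y"
  proof (cases "X \<in> carrier (padic_ring p) \<and> Y \<in> carrier (padic_ring p)")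
    case True
    then obtain a b where "padic_Cauchy p a" "X = padic_class p a" "padic_Cauchy p b" "Y = padic_class p b"
      by (auto simp: carrier_padic_ring)
    then show ?thesis
      using padic_dist_tendsto[OF p, of a b] by (auto intro: LIMSEQ_le_const)
  qed (auto simp: padic_dist_def)
  show "padic_dist p X Y = padic_dist p Y X"
  proof (cases "X \<in> carrier (padic_ring p) \<and> Y \<in> carrier (padic_ring p)")
    case True
    then obtain a b where "padic_Cauchy p a" "X = padic_class p a" "padic_Cauchy p b" "Y = padic_class p b"
      by (auto simp: carrier_padic_ring)
    then show ?thesis
      using padic_dist_tendsto[OF p, of a b] padic_dist_tendsto[OF p, of b a]
      by (simp add: padic_abs_diff_commute[of p "a _"] LIMSEQ_unique)
  qed (auto simp: padic_dist_def)
next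
  fix X Y assume "X \<in> carrier (padic_ring p)" "Y \<in> carrier (padic_ring p)"
  then obtain a b where ab: "padic_Cauchy p a" "X = padic_class p a" "padic_Cauchy p b" "Y = padic_class p b"
    by (auto simp: carrier_padic_ring)
  show "padic_dist p X Y = 0 \<longleftrightarrow> X = Y"
  proof
    assume "padic_dist p X Y = 0"
    then have "(\<lambda>n. a n - b n) \<in> padic_null p"
      using padic_dist_tendsto[OF p, of a b] ab by (simp add: padic_null_def)
    then show "X = Y" using padic_class_eq[OF p] ab by metis
  next
    assume "X = Y"
    then show "padic_dist p X Y = 0"
      using padic_dist_tendsto[OF p, of a a] ab by (simp add: LIMSEQ_const_iff)
  qed
next
  fix X Y Z assume "X \<in> carrier (padic_ring p)" "Y \<in> carrier (padic_ring p)" "Z \<in> carrier (padic_ring p)"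
  then obtain a b c where ab: "padic_Cauchy p a" "X = padic_class p a" "padic_Cauchy p b" "Y = padic_class p b"
     "padic_Cauchy p c" "Z = padic_class p c"
    by (auto simp: carrier_padic_ring)
  show "padic_dist p X Z \<le> padic_dist p X Y + padic_dist p Y Z"
  proof (rule LIMSEQ_le)
    show "(\<lambda>n. padic_abs p (a n - c n)) \<longlonglongrightarrow> padic_dist p X Z"
      using padic_dist_tendsto[OF p] ab by simp
    show "(\<lambda>n. padic_abs p (a n - b n) + padic_abs p (b n - c n)) \<longlonglongrightarrow> padic_dist p X Y + padic_dist p Y Z"
      using padic_dist_tendsto[OF p] ab by (simp add: tendsto_add)
    show "\<exists>N. \<forall>n\<ge>N. padic_abs p (a n - c n) \<le> padic_abs p (a n - b n) + padic_abs p (b n - c n)"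
    proof (intro exI allI impI)
      fix n show "padic_abs p (a n - c n) \<le> padic_abs p (a n - b n) + padic_abs p (b n - c n)"
        using padic_abs_triangle[OF p, of "a n - b n" "b n - c n"] by simp
    qed
  qed
qed

definition padic_topology :: "nat \<Rightarrow> padic topology" where
  "padic_topology p = Metric_space.mtopology (carrier (padic_ring p)) (padic_dist p)"

definition padic_integers :: "nat \<Rightarrow> padic set" where
  "padic_integers p = {X \<in> carrier (padic_ring p). padic_dist p X \<zero>\<^bsub>padic_ring p\<^esub> \<le> 1}"


lemma padic_integers_iff:
  assumes p: "prime p" and a: "padic_Cauchy p a"
    and r: "(\<lambda>n. padic_abs p (a n)) \<longlonglongrightarrow> r"
  shows "padic_class p a \<in> padic_integers p \<longleftrightarrow> r \<le> 1"
proof -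
  have "r = padic_dist p (padic_class p a) \<zero>\<^bsub>padic_ring p\<^esub>"
    using padic_dist_tendsto[OF p a padic_Cauchy_const[of p 0]] r LIMSEQ_unique
    by (auto simp: padic_zero[OF p])
  then show ?thesis using a by (auto simp: padic_integers_def carrier_padic_ring)
qed

lemma padic_integersE:
  assumes p: "prime p" and X: "X \<in> padic_integers p"
  obtains a r where "X = padic_class p a" "padic_Cauchy p a"
    "(\<lambda>n. padic_abs p (a n)) \<longlonglongrightarrow> r" "r \<le> 1" "r \<ge> 0"
proof -
  obtain a where a: "X = padic_class p a" "padic_Cauchy p a"
    using X by (auto simp: padic_integers_def carrier_padic_ring)
  obtain r where r: "(\<lambda>n. padic_abs p (a n)) \<longlonglongrightarrow> r"
    using padic_abs_convergent[OF p a(2)] by (auto simp: convergent_def)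
  moreover have "r \<ge> 0" using r by (rule LIMSEQ_le_const) auto
  ultimately show ?thesis using that a X padic_integers_iff[OF p a(2)] by blast
qed

lemma padic_integers_add:
  assumes p: "prime p" and "X \<in> padic_integers p" "Y \<in> padic_integers p"
  shows "X \<oplus>\<^bsub>padic_ring p\<^esub> Y \<in> padic_integers p"
proof -
  obtain a r where a: "X = padic_class p a" "padic_Cauchy p a"
    "(\<lambda>n. padic_abs p (a n)) \<longlonglongrightarrow> r" "r \<le> 1" using padic_integersE[OF p assms(2)] by metis
  obtain b s where b: "Y = padic_class p b" "padic_Cauchy p b"
    "(\<lambda>n. padic_abs p (b n)) \<longlonglongrightarrow> s" "s \<le> 1" using padic_integersE[OF p assms(3)] by metis
  have c: "padic_Cauchy p (\<lambda>n. a n + b n)" using padic_Cauchy_add[OF p] a b by blast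
  obtain t where t: "(\<lambda>n. padic_abs p (a n + b n)) \<longlonglongrightarrow> t"
    using padic_abs_convergent[OF p c] by (auto simp: convergent_def)
  have "t \<le> max r s"
    by (rule LIMSEQ_le[OF t tendsto_max[OF a(3) b(3)]]) (use padic_abs_add_le_max[OF p] in blast)
  then show ?thesis
    using padic_integers_iff[OF p c t] a b by (simp add: padic_add[OF p])
qed

lemma padic_integers_mult:
  assumes p: "prime p" and "X \<in> padic_integers p" "Y \<in> padic_integers p"
  shows "X \<otimes>\<^bsub>padic_ring p\<^esub> Y \<in> padic_integers p"
proof -
  obtain a r where a: "X = padic_class p a" "padic_Cauchy p a"
    "(\<lambda>n. padic_abs p (a n)) \<longlonglongrightarrow> r" "r \<le> 1" "r \<ge> 0" using padic_integersE[OF p assms(2)] by metis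
  obtain b s where b: "Y = padic_class p b" "padic_Cauchy p b"
    "(\<lambda>n. padic_abs p (b n)) \<longlonglongrightarrow> s" "s \<le> 1" "s \<ge> 0" using padic_integersE[OF p assms(3)] by metis
  have c: "padic_Cauchy p (\<lambda>n. a n * b n)" using padic_Cauchy_mult[OF p] a b by blast
  have t: "(\<lambda>n. padic_abs p (a n * b n)) \<longlonglongrightarrow> r * s"
    using tendsto_mult[OF a(3) b(3)] by (simp add: padic_abs_mult[OF p])
  have "r * s \<le> 1" using a b by (simp add: mult_le_one)
  then show ?thesis
    using padic_integers_iff[OF p c t] a b by (simp add: padic_mult[OF p])
qed

lemma padic_integers_zero: "prime p \<Longrightarrow> \<zero>\<^bsub>padic_ring p\<^esub> \<in> padic_integers p"
  using padic_integers_iff[of p "\<lambda>n. 0" 0] by (simp add: padic_zero padic_Cauchy_const)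

lemma padic_integers_one: "prime p \<Longrightarrow> \<one>\<^bsub>padic_ring p\<^esub> \<in> padic_integers p"
  using padic_integers_iff[of p "\<lambda>n. 1" 1] by (simp add: padic_one padic_Cauchy_const)

lemma padic_uminus:
  assumes p: "prime p" and a: "padic_Cauchy p a"
  shows "\<ominus>\<^bsub>padic_ring p\<^esub> padic_class p a = padic_class p (\<lambda>n. - a n)"
proof -
  interpret cring "padic_ring p" by (rule cring_padic_ring[OF p])
  show ?thesis
    using a padic_Cauchy_uminus[OF a]
    by (intro minus_equality) (auto simp: carrier_padic_ring padic_add[OF p] padic_zero[OF p])
qed

lemma padic_integers_uminus:
  assumes p: "prime p" and "X \<in> padic_integers p"
  shows "\<ominus>\<^bsub>padic_ring p\<^esub> X \<in> padic_integers p"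
proof -
  obtain a r where a: "X = padic_class p a" "padic_Cauchy p a"
    "(\<lambda>n. padic_abs p (a n)) \<longlonglongrightarrow> r" "r \<le> 1" using padic_integersE[OF p assms(2)] by metis
  then show ?thesis
    using padic_integers_iff[OF p padic_Cauchy_uminus[OF a(2)], of r] by (simp add: padic_uminus[OF p])
qed

lemma openin_padic_integers:
  assumes p: "prime p"
  shows "openin (padic_topology p) (padic_integers p)"
proof -
  interpret Metric_space "carrier (padic_ring p)" "padic_dist p" by (rule Metric_space_padic[OF p])
  have "Y \<in> padic_integers p" if X: "X \<in> padic_integers p" and Y: "Y \<in> mball X 1" for X Y
  proof -
    obtain a r where a: "X = padic_class p a" "padic_Cauchy p a"
      "(\<lambda>n. padic_abs p (a n)) \<longlonglongrightarrow> r" "r \<le> 1" using padic_integersE[OF p X] by metis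
    have "Y \<in> carrier (padic_ring p)" using Y by simp
    then obtain b where b: "Y = padic_class p b" "padic_Cauchy p b"
      by (auto simp: carrier_padic_ring)
    obtain s where s: "(\<lambda>n. padic_abs p (b n)) \<longlonglongrightarrow> s"
      using padic_abs_convergent[OF p b(2)] by (auto simp: convergent_def)
    have le: "padic_abs p (b n) \<le> max (padic_abs p (a n)) (padic_abs p (a n - b n))" for n
      using padic_abs_add_le_max[OF p, of "a n" "b n - a n"] padic_abs_diff_commute[of p "a n" "b n"]
      by simp
    have "s \<le> max r (padic_dist p X Y)"
      using padic_dist_tendsto[OF p a(2) b(2)] le a b
      by (intro LIMSEQ_le[OF s tendsto_max[OF a(3)]]) auto
    moreover have "padic_dist p X Y < 1" using Y by simp
    ultimately show ?thesis using padic_integers_iff[OF p b(2) s] a(4) b(1) by simp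
  qed
  then have "mball X 1 \<subseteq> padic_integers p" if "X \<in> padic_integers p" for X
    using that by blast
  moreover have "padic_integers p \<subseteq> carrier (padic_ring p)"
    by (auto simp: padic_integers_def)
  ultimately show ?thesis
    unfolding padic_topology_def openin_mtopology using zero_less_one by blast
qed

lemma topspace_padic_topology: "prime p \<Longrightarrow> topspace (padic_topology p) = carrier (padic_ring p)"
  unfolding padic_topology_def by (rule Metric_space.topspace_mtopology[OF Metric_space_padic])

section \<open>The adele ring\<close>

definition finite_adeles :: "(nat \<Rightarrow> padic) set" where
  "finite_adeles =
     {x \<in> (\<Pi>\<^sub>E p\<in>{p. prime p}. carrier (padic_ring p)). finite {p. prime p \<and> x p \<notin> padic_integers p}}"

definition finite_adele_ring :: "(nat \<Rightarrow> padic) ring" where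
  "finite_adele_ring =
     \<lparr>carrier = finite_adeles,
      mult = (\<lambda>x y. \<lambda>p\<in>{p. prime p}. x p \<otimes>\<^bsub>padic_ring p\<^esub> y p),
      one = (\<lambda>p\<in>{p. prime p}. \<one>\<^bsub>padic_ring p\<^esub>),
      zero = (\<lambda>p\<in>{p. prime p}. \<zero>\<^bsub>padic_ring p\<^esub>),
      add = (\<lambda>x y. \<lambda>p\<in>{p. prime p}. x p \<oplus>\<^bsub>padic_ring p\<^esub> y p)\<rparr>"

lemma finite_adelesI:
  assumes "\<And>p. prime p \<Longrightarrow> h p \<in> carrier (padic_ring p)"
    and "finite F" and "\<And>p. prime p \<Longrightarrow> p \<notin> F \<Longrightarrow> h p \<in> padic_integers p"
  shows "(\<lambda>p\<in>{p. prime p}. h p) \<in> finite_adeles"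
  unfolding finite_adeles_def
  using assms by (auto intro: finite_subset[of _ F])

lemma finite_adelesD:
  assumes "x \<in> finite_adeles"
  shows "prime p \<Longrightarrow> x p \<in> carrier (padic_ring p)"
    and "finite {p. prime p \<and> x p \<notin> padic_integers p}"
    and "x \<in> extensional {p. prime p}"
  using assms by (auto simp: finite_adeles_def PiE_def)

lemma cring_finite_adele_ring: "cring finite_adele_ring"
proof -
  have ops:
    "(\<lambda>p\<in>{p. prime p}. x p \<oplus>\<^bsub>padic_ring p\<^esub> y p) \<in> finite_adeles"
    "(\<lambda>p\<in>{p. prime p}. x p \<otimes>\<^bsub>padic_ring p\<^esub> y p) \<in> finite_adeles"
    if "x \<in> finite_adeles" "y \<in> finite_adeles" for x y
    using that finite_adelesD[of x] finite_adelesD[of y] padic_integers_add padic_integers_mult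
    by (auto intro!: finite_adelesI[where F = "{p. prime p \<and> x p \<notin> padic_integers p} \<union>
            {p. prime p \<and> y p \<notin> padic_integers p}"] cring.cring_simprules(1,5) cring_padic_ring)
  have units: "(\<lambda>p\<in>{p. prime p}. \<zero>\<^bsub>padic_ring p\<^esub>) \<in> finite_adeles"
    "(\<lambda>p\<in>{p. prime p}. \<one>\<^bsub>padic_ring p\<^esub>) \<in> finite_adeles"
    by (auto intro!: finite_adelesI[where F = "{}"] padic_integers_zero padic_integers_one
        cring.cring_simprules(2,6) cring_padic_ring)
  have uminus: "(\<lambda>p\<in>{p. prime p}. \<ominus>\<^bsub>padic_ring p\<^esub> x p) \<in> finite_adeles"
    if "x \<in> finite_adeles" for x
    using that finite_adelesD[of x] padic_integers_uminus
    by (auto intro!: finite_adelesI[where F = "{p. prime p \<and> x p \<notin> padic_integers p}"]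
        cring.cring_simprules(3) cring_padic_ring)
  note c = cring_padic_ring and d = finite_adelesD(1)
  have id: "(\<lambda>p\<in>{p. prime p}. h p) = x" if "x \<in> finite_adeles" "\<And>p. prime p \<Longrightarrow> h p = x p" for h x
    using finite_adelesD(3)[OF that(1)] that(2) by (auto simp: fun_eq_iff extensional_def)
  show ?thesis
  proof (rule cringI)
    show "abelian_group finite_adele_ring"
    proof (rule abelian_groupI)
      fix x assume x: "x \<in> carrier finite_adele_ring"
      show "\<exists>y\<in>carrier finite_adele_ring. y \<oplus>\<^bsub>finite_adele_ring\<^esub> x = \<zero>\<^bsub>finite_adele_ring\<^esub>"
        using x uminus[of x]
        by (intro bexI[of _ "\<lambda>p\<in>{p. prime p}. \<ominus>\<^bsub>padic_ring p\<^esub> x p"])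
           (auto simp: finite_adele_ring_def cring.cring_simprules(9)[OF c d] intro!: restrict_ext)
    qed (auto simp: finite_adele_ring_def ops units id
          cring.cring_simprules(7)[OF c d d d] cring.cring_simprules(8)[OF c d]
          cring.cring_simprules(10)[OF c d d] intro!: restrict_ext)
    show "comm_monoid finite_adele_ring"
      by (rule comm_monoidI)
         (auto simp: finite_adele_ring_def ops units id
          cring.cring_simprules(11)[OF c d d d] cring.cring_simprules(12)[OF c d]
          cring.cring_simprules(14)[OF c d d] intro!: restrict_ext)
  qed (auto simp: finite_adele_ring_def cring.cring_simprules(13)[OF c d d d] intro!: restrict_ext)
qed

definition finite_adele_topology :: "(nat \<Rightarrow> padic) topology" where
  "finite_adele_topology =
     topology_generated_by
       {(\<Pi>\<^sub>E p\<in>{p. prime p}. U p) | U.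
          (\<forall>p. prime p \<longrightarrow> openin (padic_topology p) (U p)) \<and>
          finite {p. prime p \<and> U p \<noteq> padic_integers p}}"

lemma topspace_finite_adele_topology: "topspace finite_adele_topology = finite_adeles"
proof -
  have sub: "x \<in> finite_adeles"
    if x: "x \<in> (\<Pi>\<^sub>E p\<in>{p. prime p}. U p)" and U: "\<And>p. prime p \<Longrightarrow> openin (padic_topology p) (U p)"
      and fin: "finite {p. prime p \<and> U p \<noteq> padic_integers p}" for x U
  proof -
    have "(\<Pi>\<^sub>E p\<in>{p. prime p}. U p) \<subseteq> (\<Pi>\<^sub>E p\<in>{p. prime p}. carrier (padic_ring p))"
      using openin_subset[OF U] topspace_padic_topology by (intro PiE_mono) simp
    moreover have "finite {p. prime p \<and> x p \<notin> padic_integers p}"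
      by (rule finite_subset[OF _ fin]) (use PiE_mem[OF x] in auto)
    ultimately show ?thesis
      unfolding finite_adeles_def using x by blast
  qed
  have sup: "\<exists>U. x \<in> (\<Pi>\<^sub>E p\<in>{p. prime p}. U p) \<and>
      (\<forall>p. prime p \<longrightarrow> openin (padic_topology p) (U p)) \<and>
      finite {p. prime p \<and> U p \<noteq> padic_integers p}" if x: "x \<in> finite_adeles" for x
  proof (intro exI conjI allI impI)
    let ?U = "\<lambda>p. if x p \<in> padic_integers p then padic_integers p else carrier (padic_ring p)"
    show "x \<in> (\<Pi>\<^sub>E p\<in>{p. prime p}. ?U p)"
      using finite_adelesD[OF x] by (auto simp: PiE_def)
    show "openin (padic_topology p) (?U p)" if "prime p" for p
      using openin_padic_integers[OF that] topspace_padic_topology[OF that]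
        openin_topspace[of "padic_topology p"] by simp
    show "finite {p. prime p \<and> ?U p \<noteq> padic_integers p}"
      by (rule finite_subset[OF _ finite_adelesD(2)[OF x]]) auto
  qed
  show ?thesis
    unfolding finite_adele_topology_def topology_generated_by_topspace
  proof (intro subset_antisym subsetI)
    fix x
    assume "x \<in> \<Union>{(\<Pi>\<^sub>E p\<in>{p. prime p}. U p) | U.
          (\<forall>p. prime p \<longrightarrow> openin (padic_topology p) (U p)) \<and>
          finite {p. prime p \<and> U p \<noteq> padic_integers p}}"
    then show "x \<in> finite_adeles"
      by (elim UnionE CollectE exE conjE) (rule sub, simp_all)
  next
    fix x assume "x \<in> finite_adeles"
    from sup[OF this] obtain U where "x \<in> (\<Pi>\<^sub>E p\<in>{p. prime p}. U p)"
      "\<forall>p. prime p \<longrightarrow> openin (padic_topology p) (U p)"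
      "finite {p. prime p \<and> U p \<noteq> padic_integers p}"
      by (elim exE conjE)
    then show "x \<in> \<Union>{(\<Pi>\<^sub>E p\<in>{p. prime p}. U p) | U.
          (\<forall>p. prime p \<longrightarrow> openin (padic_topology p) (U p)) \<and>
          finite {p. prime p \<and> U p \<noteq> padic_integers p}}"
      by (intro UnionI CollectI exI conjI) (rule refl)
  qed
qed

type_synonym adele = "real \<times> (nat \<Rightarrow> padic)"

definition adele_ring :: "adele ring" where
  "adele_ring =
     \<lparr>carrier = UNIV \<times> finite_adeles,
      mult = (\<lambda>x y. (fst x * fst y, snd x \<otimes>\<^bsub>finite_adele_ring\<^esub> snd y)),
      one = (1, \<one>\<^bsub>finite_adele_ring\<^esub>),
      zero = (0, \<zero>\<^bsub>finite_adele_ring\<^esub>),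
      add = (\<lambda>x y. (fst x + fst y, snd x \<oplus>\<^bsub>finite_adele_ring\<^esub> snd y))\<rparr>"

lemma cring_adele_ring: "cring adele_ring"
proof -
  interpret F: cring finite_adele_ring by (rule cring_finite_adele_ring)
  have [simp]: "finite_adeles = carrier finite_adele_ring" by (simp add: finite_adele_ring_def)
  show ?thesis
  proof (rule cringI)
    show "abelian_group adele_ring"
    proof (rule abelian_groupI)
      fix x assume "x \<in> carrier adele_ring"
      then show "\<exists>y\<in>carrier adele_ring. y \<oplus>\<^bsub>adele_ring\<^esub> x = \<zero>\<^bsub>adele_ring\<^esub>"
        by (intro bexI[of _ "(- fst x, \<ominus>\<^bsub>finite_adele_ring\<^esub> snd x)"])
           (auto simp: adele_ring_def F.l_neg)
    qed (auto simp: adele_ring_def F.add.m_ac)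
    show "comm_monoid adele_ring"
      by (rule comm_monoidI) (auto simp: adele_ring_def F.m_ac)
  qed (auto simp: adele_ring_def F.l_distr distrib_right)
qed

definition adele_topology :: "adele topology" where
  "adele_topology = prod_topology euclideanreal finite_adele_topology"

lemma topspace_adele_topology: "topspace adele_topology = carrier adele_ring"
  by (simp add: adele_topology_def adele_ring_def topspace_finite_adele_topology)

definition adele_of_rat :: "rat \<Rightarrow> adele" where
  "adele_of_rat q = (of_rat q, \<lambda>p\<in>{p. prime p}. padic_of_rat p q)"


lemma padic_of_rat_integer:
  assumes p: "prime p" and "\<not> int p dvd snd (quotient_of q)"
  shows "padic_of_rat p q \<in> padic_integers p"
proof -
  have "padic_abs p q \<le> 1"
    using assms prime_ge_1_nat[OF p]
    by (auto simp: padic_abs_def not_dvd_imp_multiplicity_0 divide_le_eq)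
  then show ?thesis
    unfolding padic_of_rat_def
    using padic_integers_iff[OF p padic_Cauchy_const[of p q] tendsto_const] by blast
qed

lemma adele_of_rat_carrier: "adele_of_rat q \<in> carrier adele_ring"
proof -
  have "finite {p::nat. int p dvd snd (quotient_of q)}"
  proof (rule finite_subset)
    have pos: "snd (quotient_of q) > 0" by (rule quotient_of_denom_pos')
    show "{p::nat. int p dvd snd (quotient_of q)} \<subseteq> {..nat (snd (quotient_of q))}"
    proof safe
      fix p assume "int p dvd snd (quotient_of q)"
      then have "int p \<le> snd (quotient_of q)" using pos by (rule zdvd_imp_le)
      then show "p \<le> nat (snd (quotient_of q))" by linarith
    qed
  qed simp
  then have "(\<lambda>p\<in>{p. prime p}. padic_of_rat p q) \<in> finite_adeles"
  proof (rule finite_adelesI[rotated])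
    show "padic_of_rat p q \<in> carrier (padic_ring p)" if "prime p" for p
      by (simp add: padic_of_rat_def carrier_padic_ring padic_Cauchy_const)
    show "padic_of_rat p q \<in> padic_integers p"
      if "prime p" "p \<notin> {p. int p dvd snd (quotient_of q)}" for p
      using that by (simp add: padic_of_rat_integer)
  qed
  then show ?thesis by (simp add: adele_of_rat_def adele_ring_def)
qed

lemma adele_of_rat_add:
  "adele_of_rat (q + r) = adele_of_rat q \<oplus>\<^bsub>adele_ring\<^esub> adele_of_rat r"
  by (simp add: adele_of_rat_def adele_ring_def finite_adele_ring_def padic_of_rat_def
      of_rat_add restrict_def fun_eq_iff padic_add padic_Cauchy_const)

lemma normal_range_adele_of_rat: "normal (range adele_of_rat) (add_monoid adele_ring)"
proof -
  interpret A: cring adele_ring by (rule cring_adele_ring)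
  have zero: "adele_of_rat 0 = \<zero>\<^bsub>adele_ring\<^esub>"
    by (simp add: adele_of_rat_def adele_ring_def finite_adele_ring_def padic_of_rat_def
        restrict_def fun_eq_iff padic_zero)
  have inv: "\<ominus>\<^bsub>adele_ring\<^esub> adele_of_rat q = adele_of_rat (- q)" for q
    by (rule A.minus_equality) (simp_all add: adele_of_rat_carrier adele_of_rat_add[symmetric] zero)
  have "subgroup (range adele_of_rat) (add_monoid adele_ring)"
  proof (rule A.add.subgroupI)
    show "\<ominus>\<^bsub>adele_ring\<^esub> x \<in> range adele_of_rat" if "x \<in> range adele_of_rat" for x
      using that inv by auto
    show "x \<oplus>\<^bsub>adele_ring\<^esub> y \<in> range adele_of_rat"
      if "x \<in> range adele_of_rat" "y \<in> range adele_of_rat" for x y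
      using that by (auto simp: adele_of_rat_add[symmetric])
  qed (auto simp: adele_of_rat_carrier)
  then show ?thesis
    by (rule comm_group.subgroup_imp_normal[OF A.a_comm_group])
qed


section \<open>The quotient \<open>\<bbbA>/\<rat>\<close>\<close>

definition adele_class :: "adele \<Rightarrow> adele set" where
  "adele_class x = range adele_of_rat +>\<^bsub>adele_ring\<^esub> x"

definition adele_class_topology :: "adele set topology" where
  "adele_class_topology =
     topology (\<lambda>U. U \<subseteq> carrier (adele_ring A_Mod range adele_of_rat) \<and>
                   openin adele_topology {x \<in> carrier adele_ring. adele_class x \<in> U})"

lemma openin_adele_class_topology:
  "openin adele_class_topology U \<longleftrightarrow>
     U \<subseteq> carrier (adele_ring A_Mod range adele_of_rat) \<and>
     openin adele_topology {x \<in> carrier adele_ring. adele_class x \<in> U}"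
proof -
  have "istopology (\<lambda>U. U \<subseteq> carrier (adele_ring A_Mod range adele_of_rat) \<and>
                   openin adele_topology {x \<in> carrier adele_ring. adele_class x \<in> U})"
    unfolding istopology_def
  proof (intro conjI allI impI)
    fix S T
    assume "S \<subseteq> carrier (adele_ring A_Mod range adele_of_rat) \<and>
        openin adele_topology {x \<in> carrier adele_ring. adele_class x \<in> S}"
      and "T \<subseteq> carrier (adele_ring A_Mod range adele_of_rat) \<and>
        openin adele_topology {x \<in> carrier adele_ring. adele_class x \<in> T}"
    moreover have "{x \<in> carrier adele_ring. adele_class x \<in> S \<inter> T} =
        {x \<in> carrier adele_ring. adele_class x \<in> S} \<inter> {x \<in> carrier adele_ring. adele_class x \<in> T}"
      by blast
    ultimately show "S \<inter> T \<subseteq> carrier (adele_ring A_Mod range adele_of_rat)"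
      and "openin adele_topology {x \<in> carrier adele_ring. adele_class x \<in> S \<inter> T}"
      by auto
  next
    fix K
    assume K: "\<forall>S\<in>K. S \<subseteq> carrier (adele_ring A_Mod range adele_of_rat) \<and>
        openin adele_topology {x \<in> carrier adele_ring. adele_class x \<in> S}"
    then show "\<Union>K \<subseteq> carrier (adele_ring A_Mod range adele_of_rat)" by blast
    have "{x \<in> carrier adele_ring. adele_class x \<in> \<Union>K} =
        (\<Union>S\<in>K. {x \<in> carrier adele_ring. adele_class x \<in> S})" by blast
    then show "openin adele_topology {x \<in> carrier adele_ring. adele_class x \<in> \<Union>K}"
      using K by auto
  qed
  then show ?thesis by (simp add: adele_class_topology_def topology_inverse')
qed

lemma quotient_map_adele_class: "quotient_map adele_topology adele_class_topology adele_class"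
proof -
  have img: "adele_class ` carrier adele_ring = carrier (adele_ring A_Mod range adele_of_rat)"
    unfolding A_FactGroup_def FactGroup_def partial_object.simps A_RCOSETS_def[symmetric]
    by (auto simp: A_RCOSETS_def' adele_class_def)
  then have pre: "{x \<in> carrier adele_ring. adele_class x \<in> carrier (adele_ring A_Mod range adele_of_rat)}
      = carrier adele_ring" by blast
  have "openin adele_class_topology (carrier (adele_ring A_Mod range adele_of_rat))"
    unfolding openin_adele_class_topology pre
    using openin_topspace[of adele_topology] by (simp add: topspace_adele_topology)
  moreover have "topspace adele_class_topology \<subseteq> carrier (adele_ring A_Mod range adele_of_rat)"
    using openin_adele_class_topology[of "topspace adele_class_topology"] by blast
  ultimately have "topspace adele_class_topology = carrier (adele_ring A_Mod range adele_of_rat)"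
    using openin_subset by blast
  then show ?thesis
    using img by (auto simp: quotient_map_def topspace_adele_topology openin_adele_class_topology)
qed

abbreviation circle :: "complex topology" where
  "circle \<equiv> top_of_set (sphere 0 1)"


section \<open>Generalized winding numbers\<close>

definition pre_periodic :: "(real \<Rightarrow> complex) \<Rightarrow> bool" where
  "pre_periodic h \<longleftrightarrow>
     continuous_on UNIV h \<and> range h \<subseteq> sphere 0 1 \<and>
     (\<forall>e>0. \<exists>N::nat. N > 0 \<and>
        (\<forall>k::int. \<forall>x::real. norm (h (x + of_int k * of_nat N) - h x) < e))"

definition circle_lift :: "(real \<Rightarrow> complex) \<Rightarrow> (real \<Rightarrow> real) \<Rightarrow> bool" where
  "circle_lift h l \<longleftrightarrow>
     continuous_on UNIV l \<and> (\<forall>x. exp (2 * of_real pi * \<i> * of_real (l x)) = h x)"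

text \<open>For pre-periodic \<open>h\<close> the limit exists and is the same for all lifts.\<close>

definition gen_winding_number :: "(real \<Rightarrow> complex) \<Rightarrow> real" where
  "gen_winding_number h =
     (THE w. pre_periodic h \<and>
        (\<exists>l. circle_lift h l \<and> ((\<lambda>x. (l x - l (- x)) / (2 * x)) \<longlongrightarrow> w) at_top))"

definition adele_winding_number :: "(adele set \<Rightarrow> complex) \<Rightarrow> real" where
  "adele_winding_number g =
     gen_winding_number (\<lambda>x. g (adele_class (x, \<zero>\<^bsub>finite_adele_ring\<^esub>)))"

end

theory Submission
  imports Defs
begin

text \<open>
  By strong approximation every finite adele \<open>z\<close> is close to a rational \<open>q\<close>, so a \<open>\<rat>\<close>-periodic
  function satisfies \<open>h(x, z) = h(x - q, z - q) \<approx> h(x - q, 0)\<close>: up to a small error, which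
  compactness makes uniform, it is determined by its restriction to the real line, and this
  restriction is nearly \<open>N\<close>-periodic for some \<open>N\<close>. Uniformly close maps have the same winding
  number, so the winding number is locally constant along a homotopy. Conversely, if \<open>f\<close> and \<open>g\<close>
  have equal winding numbers, then the lift of \<open>(g/f)\<^sub>0\<close> to the real line is nearly periodic; it
  yields a continuous logarithm of \<open>g/f\<close> on \<open>\<bbbA>/\<rat>\<close>, which is contracted linearly to \<open>0\<close>.
\<close>

section \<open>Arithmetic of the \<open>p\<close>-adic absolute value\<close>

text \<open>Write Zhat for the integral finite adeles. The groups N Zhat form a neighbourhood basis
  of 0 in the finite adeles, and Q meets N Zhat in N Z. So A/Q modulo N Zhat is the circle R/NZ, and
  A/Q is the inverse limit of these circles; the numbers N below are levels of that limit. The limit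
  is never formed: a function is moved between level N and A/Q by choosing a rational q within N
  Zhat of the finite coordinate, and any two choices differ by a multiple of N. The obstacle to a
  logarithm on A/Q is that lifts exist only on the real line, whose image is dense but carries a
  coarser topology than R, so a lift need not extend. Instead of building an extension as a limit of
  periodic approximations, a single periodic function suffices, off by less than 1/3 of a turn on
  the real line: the remaining factor avoids -1, and the principal argument supplies the rest at
  once. The constants come from chord lengths: points of the circle at distance less than 1 are less
  than 1/6 of a turn apart, and three such errors stay below an integer step.\<close>

lemma padic_abs_of_int_le_1: "prime p \<Longrightarrow> padic_abs p (of_int a) \<le> 1"
  using prime_ge_1_nat[of p] by (auto simp: padic_abs_def divide_le_eq)

lemma padic_abs_of_nat_le_1: "prime p \<Longrightarrow> padic_abs p (of_nat a) \<le> 1"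
  using padic_abs_of_int_le_1[of p "int a"] by simp

lemma padic_abs_of_nat_pos: "prime p \<Longrightarrow> 0 < n \<Longrightarrow> 0 < padic_abs p (of_nat n)"
  by (metis less_eq_real_def of_nat_eq_0_iff padic_abs_eq_0 padic_abs_nonneg less_not_refl)

lemma padic_abs_inverse:
  assumes "prime p" shows "padic_abs p (inverse x) = inverse (padic_abs p x)"
proof (cases "x = 0")
  case False
  then have "padic_abs p x * padic_abs p (inverse x) = 1"
    using padic_abs_mult[OF assms, of x "inverse x"] by simp
  then show ?thesis by (metis inverse_unique)
qed simp

lemma padic_abs_divide: "prime p \<Longrightarrow> padic_abs p (x / y) = padic_abs p x / padic_abs p y"
  by (simp add: divide_inverse padic_abs_mult padic_abs_inverse)

lemma padic_abs_power: "prime p \<Longrightarrow> padic_abs p (x ^ k) = padic_abs p x ^ k"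
  by (induction k) (simp_all add: padic_abs_mult)

lemma padic_abs_prime: assumes "prime p" shows "padic_abs p (of_nat p) = 1 / real p"
proof -
  have "quotient_of (of_nat p) = (int p, 1)" using quotient_of_int[of "int p"] by simp
  moreover have "multiplicity (int p) (int p) = 1"
    using assms by (intro multiplicity_self) auto
  ultimately show ?thesis using assms prime_gt_0_nat[OF assms] by (simp add: padic_abs_def)
qed

lemma padic_abs_of_int_dvd:
  assumes p: "prime p" and "int p ^ k dvd a"
  shows "padic_abs p (of_int a) \<le> 1 / real p ^ k"
proof -
  obtain b where a: "a = int p ^ k * b" using assms by (elim dvdE)
  have "padic_abs p (of_int a) = (1 / real p) ^ k * padic_abs p (of_int b)"
    by (simp add: a padic_abs_mult[OF p] padic_abs_power[OF p] padic_abs_prime[OF p])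
  also have "\<dots> \<le> (1 / real p) ^ k * 1"
    by (intro mult_left_mono padic_abs_of_int_le_1 p) simp
  finally show ?thesis by (simp add: power_one_over)
qed

lemma padic_abs_of_int_coprime:
  assumes "prime p" and "\<not> int p dvd a"
  shows "padic_abs p (of_int a) = 1"
  using assms by (auto simp: padic_abs_def not_dvd_imp_multiplicity_0)

lemma padic_abs_of_prime_other:
  assumes "prime p" "prime l" "l \<noteq> p"
  shows "padic_abs l (of_nat p) = 1"
  using padic_abs_of_int_coprime[of l "int p"] assms
  by (metis int_dvd_int_iff of_int_of_nat_eq primes_dvd_imp_eq)

lemma padic_abs_le_1_imp_coprime_denom:
  assumes p: "prime p" and le: "padic_abs p q \<le> 1"
  shows "\<not> int p dvd snd (quotient_of q)"
proof
  define n d where "n = fst (quotient_of q)" and "d = snd (quotient_of q)"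
  have q: "quotient_of q = (n, d)" by (simp add: n_def d_def)
  have dpos: "d > 0" and cop: "coprime n d"
    using quotient_of_denom_pos[OF q] quotient_of_coprime[OF q] by auto
  assume "int p dvd snd (quotient_of q)"
  then have pd: "int p dvd d" by (simp add: d_def)
  have nu: "\<not> is_unit (int p)" using p by (metis not_prime_unit prime_nat_int_transfer)
  then have pn: "\<not> int p dvd n" using cop pd by (meson coprime_common_divisor)
  then have "q \<noteq> 0" using q by auto
  have "multiplicity (int p) d > 0"
    using pd dpos nu by (simp add: multiplicity_gt_zero_iff)
  then have "real p ^ multiplicity (int p) d > 1"
    using prime_gt_1_nat[OF p] by (intro one_less_power) auto
  then show False
    using le \<open>q \<noteq> 0\<close> pn by (simp add: padic_abs_def q not_dvd_imp_multiplicity_0)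
qed

text \<open>A prime factor of the reduced denominator would push its absolute value above 1. In
  adelic terms, the only rationals in Zhat are the integers.\<close>

lemma rat_Ints_if_padic_integral:
  assumes "\<And>p. prime p \<Longrightarrow> padic_abs p q \<le> 1"
  shows "q \<in> \<int>"
proof -
  obtain n d where q: "quotient_of q = (n, d)" by (cases "quotient_of q") auto
  have d: "d > 0" using quotient_of_denom_pos[OF q] .
  have "d = 1"
  proof (rule ccontr)
    assume "d \<noteq> 1"
    then have "nat d \<noteq> 1" using d by linarith
    then obtain p where p: "prime p" "p dvd nat d" using prime_factor_nat by blast
    then have "int p dvd d" using d by (metis int_dvd_int_iff int_nat_eq less_imp_le)
    then show False using padic_abs_le_1_imp_coprime_denom[OF p(1) assms[OF p(1)]] q by simp
  qed
  then show ?thesis using quotient_of_div[OF q] by simp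
qed

text \<open>In lowest terms q = u/v with v prime to p, so Bezout gives an inverse s of v modulo p^k,
  and the residue of u*s approximates q. These finitely many residues later give total
  boundedness.\<close>

lemma padic_residue:
  assumes p: "prime p" and le: "padic_abs p q \<le> 1"
  obtains j :: nat where "j < p ^ k" "padic_abs p (q - of_nat j) \<le> 1 / real p ^ k"
proof -
  obtain u v where q: "quotient_of q = (u, v)" by (cases "quotient_of q") auto
  have v: "v > 0" using quotient_of_denom_pos[OF q] .
  have pv: "\<not> int p dvd v" using padic_abs_le_1_imp_coprime_denom[OF p le] q by simp
  have "prime (int p)" using p by simp
  then have "coprime v (int p ^ k)"
    using pv by (metis coprime_commute coprime_power_left_iff prime_imp_coprime)
  then obtain s t where st: "s * v + t * int p ^ k = 1"
    using bezout_int[of v "int p ^ k"] by auto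
  have pk: "int p ^ k > 0" using prime_gt_0_nat[OF p] by simp
  define j where "j = (u * s) mod (int p ^ k)"
  have j0: "0 \<le> j" "j < int p ^ k" using pk by (simp_all add: j_def)
  have "int p ^ k dvd u * s - j" by (simp add: j_def minus_mod_eq_mult_div)
  then obtain c where c: "u * s - j = int p ^ k * c" by (elim dvdE)
  have "u - j * v = u * (s * v + t * int p ^ k) - (u * s - int p ^ k * c) * v"
    using c by (simp add: st algebra_simps)
  also have "\<dots> = int p ^ k * (u * t + c * v)" by (simp add: algebra_simps)
  finally have dv: "int p ^ k dvd u - j * v" by simp
  have "q - of_nat (nat j) = of_int (u - j * v) / of_int v"
    using quotient_of_div[OF q] v j0 by (simp add: field_simps)
  then have "padic_abs p (q - of_nat (nat j)) = padic_abs p (of_int (u - j * v)) / padic_abs p (of_int v)"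
    by (simp only: padic_abs_divide[OF p])
  also have "\<dots> \<le> 1 / real p ^ k"
    using padic_abs_of_int_dvd[OF p dv] padic_abs_of_int_coprime[OF p pv] by simp
  finally show ?thesis
    using that[of "nat j"] j0 by (metis nat_less_iff of_nat_power)
qed

text \<open>Multiplying q by the power of p in its denominator makes it p-integral. An integer
  residue j of the product, divided back by that power, has only p in its denominator and carries
  the whole non-integral p-part of q.\<close>

lemma rat_partial_fraction:
  assumes p: "prime p"
  obtains r where "padic_abs p (q - r) \<le> 1" "\<And>l. prime l \<Longrightarrow> l \<noteq> p \<Longrightarrow> padic_abs l r \<le> 1"
proof -
  define k where "k = multiplicity (int p) (snd (quotient_of q))"
  have p0: "real p > 0" using prime_gt_0_nat[OF p] by simp
  have "padic_abs p q \<le> real p ^ k"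
    using p0 prime_ge_1_nat[OF p] by (auto simp: padic_abs_def k_def field_simps mult_le_cancel_left1)
  then have "padic_abs p (q * of_nat p ^ k) \<le> 1"
    using p0 by (simp add: padic_abs_mult[OF p] padic_abs_power[OF p] padic_abs_prime[OF p] field_simps)
  then obtain j where j: "padic_abs p (q * of_nat p ^ k - of_nat j) \<le> 1 / real p ^ k"
    using padic_residue[OF p] by metis
  define r :: rat where "r = of_nat j / of_nat p ^ k"
  have "q - r = (q * of_nat p ^ k - of_nat j) / of_nat p ^ k"
    using p0 by (simp add: r_def field_simps)
  then have "padic_abs p (q - r) = padic_abs p (q * of_nat p ^ k - of_nat j) * real p ^ k"
    by (simp add: padic_abs_divide[OF p] padic_abs_power[OF p] padic_abs_prime[OF p] power_one_over)
  also have "\<dots> \<le> 1" using j p0 by (simp add: field_simps)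
  finally have "padic_abs p (q - r) \<le> 1" .
  moreover have "padic_abs l r \<le> 1" if "prime l" "l \<noteq> p" for l
    using that p by (simp add: r_def padic_abs_divide padic_abs_power padic_abs_of_prime_other
        padic_abs_of_nat_le_1)
  ultimately show ?thesis using that by blast
qed

text \<open>One prime is added at a time. The correction r for the new prime is integral at all
  other primes, so by the ultrametric inequality it preserves the bounds already reached.\<close>

lemma rat_strong_approximation:
  assumes "finite F" "\<And>p. p \<in> F \<Longrightarrow> prime p"
  obtains q where "\<And>p. p \<in> F \<Longrightarrow> padic_abs p (b p - q) \<le> 1"
    "\<And>p. prime p \<Longrightarrow> p \<notin> F \<Longrightarrow> padic_abs p q \<le> 1"
  using assms
proof (induction F arbitrary: thesis rule: finite_induct)
  case empty
  show ?case by (rule empty(1)[of 0]) auto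
next
  case (insert l F)
  obtain q where q: "\<And>p. p \<in> F \<Longrightarrow> padic_abs p (b p - q) \<le> 1"
    "\<And>p. prime p \<Longrightarrow> p \<notin> F \<Longrightarrow> padic_abs p q \<le> 1"
    using insert.IH insert.prems(2) by (metis insertCI)
  have l: "prime l" using insert.prems by simp
  obtain r where r: "padic_abs l (b l - q - r) \<le> 1" "\<And>p. prime p \<Longrightarrow> p \<noteq> l \<Longrightarrow> padic_abs p r \<le> 1"
    using rat_partial_fraction[OF l] by metis
  show ?case
  proof (rule insert.prems(1)[of "q + r"])
    fix p assume p: "p \<in> insert l F"
    then have pp: "prime p" using insert.prems by blast
    show "padic_abs p (b p - (q + r)) \<le> 1"
    proof (cases "p = l")
      case True then show ?thesis using r by (simp add: diff_diff_eq)
    next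
      case False
      then show ?thesis
        using padic_abs_add_le_max[OF pp, of "b p - q" "- r"] q(1)[of p] r(2)[of p] p pp
        by (simp add: algebra_simps)
    qed
  next
    fix p assume "prime p" "p \<notin> insert l F"
    then show "padic_abs p (q + r) \<le> 1"
      using padic_abs_add_le_max[of p q r] q(2)[of p] r(2)[of p] by auto
  qed
qed

section \<open>The metric on the \<open>p\<close>-adic numbers\<close>

lemma padic_of_rat_carrier [simp]: "padic_of_rat p q \<in> carrier (padic_ring p)"
  by (simp add: padic_of_rat_def carrier_padic_ring padic_Cauchy_const)

lemma padic_of_rat_0: "prime p \<Longrightarrow> padic_of_rat p 0 = \<zero>\<^bsub>padic_ring p\<^esub>"
  by (simp add: padic_of_rat_def padic_zero)

lemma padic_ringE:
  assumes "X \<in> carrier (padic_ring p)"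
  obtains a where "padic_Cauchy p a" "X = padic_class p a"
  using assms by (auto simp: carrier_padic_ring)

lemma padic_dist_of_rat:
  assumes p: "prime p"
  shows "padic_dist p (padic_of_rat p a) (padic_of_rat p b) = padic_abs p (a - b)"
  using padic_dist_tendsto[OF p padic_Cauchy_const[of p a] padic_Cauchy_const[of p b]]
  by (simp add: padic_of_rat_def LIMSEQ_const_iff)

lemma padic_dist_ultrametric:
  assumes p: "prime p" and "X \<in> carrier (padic_ring p)" "Y \<in> carrier (padic_ring p)"
    "Z \<in> carrier (padic_ring p)"
  shows "padic_dist p X Z \<le> max (padic_dist p X Y) (padic_dist p Y Z)"
proof -
  obtain a b c where a: "padic_Cauchy p a" "X = padic_class p a" and b: "padic_Cauchy p b" "Y = padic_class p b"
    and c: "padic_Cauchy p c" "Z = padic_class p c"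
    using assms padic_ringE by metis
  have "padic_abs p (a n - c n) \<le> max (padic_abs p (a n - b n)) (padic_abs p (b n - c n))" for n
    using padic_abs_add_le_max[OF p, of "a n - b n" "b n - c n"] by simp
  then show ?thesis
    unfolding a b c
    by (intro LIMSEQ_le[OF padic_dist_tendsto tendsto_max[OF padic_dist_tendsto padic_dist_tendsto]]
         p a(1) b(1) c(1)) blast
qed

lemma padic_dist_commute: "prime p \<Longrightarrow> padic_dist p X Y = padic_dist p Y X"
  by (rule Metric_space.commute[OF Metric_space_padic])

lemma padic_dist_add_right:
  assumes p: "prime p" and "X \<in> carrier (padic_ring p)" "Y \<in> carrier (padic_ring p)"
    "Z \<in> carrier (padic_ring p)"
  shows "padic_dist p (X \<oplus>\<^bsub>padic_ring p\<^esub> Z) (Y \<oplus>\<^bsub>padic_ring p\<^esub> Z) = padic_dist p X Y"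
proof -
  obtain a b c where a: "padic_Cauchy p a" "X = padic_class p a" and b: "padic_Cauchy p b" "Y = padic_class p b"
    and c: "padic_Cauchy p c" "Z = padic_class p c"
    using assms padic_ringE by metis
  have "(\<lambda>n. padic_abs p ((a n + c n) - (b n + c n)))
      \<longlonglongrightarrow> padic_dist p (padic_class p (\<lambda>n. a n + c n)) (padic_class p (\<lambda>n. b n + c n))"
    by (intro padic_dist_tendsto padic_Cauchy_add p a b c)
  then show ?thesis
    using padic_dist_tendsto[OF p a(1) b(1)] LIMSEQ_unique
    by (auto simp: a b c padic_add[OF p a(1) c(1)] padic_add[OF p b(1) c(1)])
qed

lemma padic_of_rat_dense:
  assumes p: "prime p" and "X \<in> carrier (padic_ring p)" and e: "e > 0"
  obtains q where "padic_dist p X (padic_of_rat p q) < e"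
proof -
  obtain a where a: "padic_Cauchy p a" "X = padic_class p a"
    using assms padic_ringE by metis
  have "e / 2 > 0" using e by simp
  then obtain N where N: "\<And>m n. m \<ge> N \<Longrightarrow> n \<ge> N \<Longrightarrow> padic_abs p (a m - a n) < e / 2"
    using a unfolding padic_Cauchy_def by blast
  have "padic_dist p X (padic_of_rat p (a N)) \<le> e / 2"
    unfolding a padic_of_rat_def
    by (rule LIMSEQ_le_const2[OF padic_dist_tendsto[OF p a(1) padic_Cauchy_const]])
       (use N[of _ N] in \<open>auto intro: less_imp_le\<close>)
  then show ?thesis using that[of "a N"] e by simp
qed

lemma padic_integers_dist:
  assumes "prime p"
  shows "padic_integers p = {X \<in> carrier (padic_ring p). padic_dist p X (padic_of_rat p 0) \<le> 1}"
  by (simp add: padic_integers_def padic_of_rat_0[OF assms])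

lemma padic_of_rat_in_integers:
  assumes "prime p" shows "padic_of_rat p q \<in> padic_integers p \<longleftrightarrow> padic_abs p q \<le> 1"
  by (simp add: padic_integers_dist padic_dist_of_rat assms)

text \<open>By the ultrametric inequality, the open ball of the same radius around any point of the
  closed ball stays inside it.\<close>

lemma openin_padic_cball:
  assumes p: "prime p" and X: "X \<in> carrier (padic_ring p)" and r: "r > 0"
  shows "openin (padic_topology p) {Y \<in> carrier (padic_ring p). padic_dist p Y X \<le> r}" (is "openin _ ?B")
proof -
  interpret Metric_space "carrier (padic_ring p)" "padic_dist p" by (rule Metric_space_padic[OF p])
  have "mball Y r \<subseteq> ?B" if "Y \<in> ?B" for Y
  proof
    fix Z assume "Z \<in> mball Y r"
    then show "Z \<in> ?B"
      using that padic_dist_ultrametric[OF p, of Z Y X] X by (auto simp: padic_dist_commute[OF p, of Z Y])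
  qed
  then show ?thesis
    unfolding padic_topology_def openin_mtopology using r by blast
qed

text \<open>Each term of the Cauchy sequence is replaced by a rational within 1/(n+1) of it. These
  rationals form a p-adic Cauchy sequence themselves, and its class is the limit.\<close>

lemma mcomplete_padic:
  assumes p: "prime p"
  shows "Metric_space.mcomplete (carrier (padic_ring p)) (padic_dist p)"
proof -
  interpret Metric_space "carrier (padic_ring p)" "padic_dist p" by (rule Metric_space_padic[OF p])
  show ?thesis
    unfolding mcomplete_def
  proof (intro allI impI)
    fix \<sigma> assume \<sigma>: "MCauchy \<sigma>"
    then have car: "\<sigma> n \<in> carrier (padic_ring p)" for n by (auto simp: MCauchy_def)
    have "\<exists>q. padic_dist p (\<sigma> n) (padic_of_rat p q) < 1 / real (Suc n)" for n
      using padic_of_rat_dense[OF p car, of "1 / real (Suc n)"] by auto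
    then obtain q where q: "\<And>n. padic_dist p (\<sigma> n) (padic_of_rat p (q n)) < 1 / real (Suc n)"
      by metis
    have near: "\<exists>N. \<forall>m\<ge>N. padic_dist p (\<sigma> m) (padic_of_rat p (q m)) < e" if e: "e > 0" for e :: real
    proof -
      obtain N where N: "1 / real (Suc N) < e" using nat_approx_posE[OF e] by blast
      have "1 / real (Suc m) \<le> 1 / real (Suc N)" if "m \<ge> N" for m
        using that by (intro divide_left_mono) auto
      then show ?thesis using q N by (meson less_le_trans less_trans)
    qed
    have "padic_Cauchy p q"
      unfolding padic_Cauchy_def
    proof (intro allI impI)
      fix e :: real assume e: "e > 0"
      obtain M where M: "\<And>m. m \<ge> M \<Longrightarrow> padic_dist p (\<sigma> m) (padic_of_rat p (q m)) < e"
        using near[OF e] by blast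
      obtain N where N: "\<And>m n. m \<ge> N \<Longrightarrow> n \<ge> N \<Longrightarrow> padic_dist p (\<sigma> m) (\<sigma> n) < e"
        using \<sigma> e unfolding MCauchy_def by blast
      have "padic_abs p (q m - q n) < e" if "m \<ge> max M N" "n \<ge> max M N" for m n
      proof -
        have "padic_abs p (q m - q n) \<le>
            max (padic_dist p (padic_of_rat p (q m)) (\<sigma> m)) (padic_dist p (\<sigma> m) (padic_of_rat p (q n)))"
          using padic_dist_ultrametric[OF p padic_of_rat_carrier car padic_of_rat_carrier]
          by (simp add: padic_dist_of_rat[OF p, symmetric])
        moreover have "padic_dist p (\<sigma> m) (padic_of_rat p (q n)) \<le>
            max (padic_dist p (\<sigma> m) (\<sigma> n)) (padic_dist p (\<sigma> n) (padic_of_rat p (q n)))"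
          by (intro padic_dist_ultrametric p car padic_of_rat_carrier)
        ultimately show ?thesis
          using M[of m] M[of n] N[of m n] that by (simp add: commute)
      qed
      then show "\<exists>N. \<forall>m\<ge>N. \<forall>n\<ge>N. padic_abs p (q m - q n) < e" by blast
    qed
    note qC = this
    define X where "X = padic_class p q"
    have X: "X \<in> carrier (padic_ring p)" using qC by (simp add: X_def carrier_padic_ring)
    have "\<exists>N. \<forall>n\<ge>N. padic_dist p (\<sigma> n) X < e" if e: "e > 0" for e :: real
    proof -
      obtain M where M: "\<And>m. m \<ge> M \<Longrightarrow> padic_dist p (\<sigma> m) (padic_of_rat p (q m)) < e"
        using near[OF e] by blast
      have "e / 2 > 0" using e by simp
      then obtain N where N: "\<And>m n. m \<ge> N \<Longrightarrow> n \<ge> N \<Longrightarrow> padic_abs p (q m - q n) < e / 2"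
        using qC unfolding padic_Cauchy_def by blast
      have le: "padic_dist p (padic_of_rat p (q n)) X \<le> e / 2" if "n \<ge> N" for n
        unfolding X_def padic_of_rat_def
        by (rule LIMSEQ_le_const2[OF padic_dist_tendsto[OF p padic_Cauchy_const qC]])
           (use N[OF that] in \<open>auto intro: less_imp_le\<close>)
      have "padic_dist p (\<sigma> n) X < e" if "n \<ge> max M N" for n
        using padic_dist_ultrametric[OF p car[of n] padic_of_rat_carrier[of p "q n"] X] M[of n] le[of n] that e
        by simp
      then show ?thesis by blast
    qed
    then have "limitin mtopology \<sigma> X sequentially"
      using X car by (simp add: limitin_metric eventually_sequentially)
    then show "\<exists>X. limitin mtopology \<sigma> X sequentially" ..
  qed
qed

text \<open>The set is closed in a complete space and totally bounded: the residues modulo p^k form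
  a finite net of mesh 1/p^k.\<close>

lemma compactin_padic_integers:
  assumes p: "prime p"
  shows "compactin (padic_topology p) (padic_integers p)"
proof -
  interpret Metric_space "carrier (padic_ring p)" "padic_dist p" by (rule Metric_space_padic[OF p])
  have p1: "real p > 1" using prime_gt_1_nat[OF p] by simp
  have tb: "mtotally_bounded (padic_integers p)"
    unfolding mtotally_bounded_def
  proof (intro allI impI)
    fix e :: real assume e: "e > 0"
    obtain k where "(1 / real p) ^ k < e"
      using real_arch_pow_inv[OF e, of "1 / real p"] p1 by auto
    then have k: "1 / real p ^ k < e" by (simp add: power_one_over)
    have pk: "1 / real p ^ k > 0" "1 / real p ^ k \<le> 1" using p1 by auto
    have "\<exists>j<p ^ k. X \<in> mball (padic_of_rat p (of_nat j)) e" if X: "X \<in> padic_integers p" for X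
    proof -
      have XC: "X \<in> carrier (padic_ring p)" and X1: "padic_dist p X (padic_of_rat p 0) \<le> 1"
        using X by (auto simp: padic_integers_dist[OF p])
      obtain q where q: "padic_dist p X (padic_of_rat p q) < 1 / real p ^ k"
        using padic_of_rat_dense[OF p XC pk(1)] .
      \<comment> \<open>Being within distance 1 of X, q is p-integral and so has a residue j. The
        form q - 0 matches the distance from q to 0.\<close>
      have "padic_abs p (q - 0) \<le> 1"
        using padic_dist_ultrametric[OF p padic_of_rat_carrier[of p q] XC padic_of_rat_carrier[of p 0]]
          X1 q pk(2) unfolding padic_dist_of_rat[OF p] by (auto simp: commute[of X])
      then obtain j where j: "j < p ^ k" "padic_abs p (q - of_nat j) \<le> 1 / real p ^ k"
        using padic_residue[OF p, of q k] by auto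
      have "padic_dist p X (padic_of_rat p (of_nat j)) < e"
        using padic_dist_ultrametric[OF p XC padic_of_rat_carrier[of p q] padic_of_rat_carrier[of p "of_nat j"]]
          q j k by (simp add: padic_dist_of_rat[OF p])
      then show ?thesis using j XC by (auto simp: commute)
    qed
    then have "padic_integers p \<subseteq> (\<Union>X\<in>(\<lambda>j. padic_of_rat p (of_nat j)) ` {..<p ^ k}. mball X e)"
      by blast
    moreover have "(\<lambda>j. padic_of_rat p (of_nat j)) ` {..<p ^ k} \<subseteq> padic_integers p"
      using padic_of_rat_in_integers[OF p] padic_abs_of_nat_le_1[OF p] by blast
    ultimately show "\<exists>K. finite K \<and> K \<subseteq> padic_integers p \<and> padic_integers p \<subseteq> (\<Union>X\<in>K. mball X e)"
      by (meson finite_imageI finite_lessThan)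
  qed
  have "padic_integers p = mcball (padic_of_rat p 0) 1"
    by (auto simp: padic_integers_dist[OF p] commute)
  then have "closedin mtopology (padic_integers p)"
    by (metis closedin_mcball)
  then show ?thesis
    using tb mtotally_bounded_eq_compact_closure_of[OF mcomplete_padic[OF p]]
    by (metis closure_of_closedin padic_topology_def)
qed

section \<open>Neighbourhoods of finite adeles\<close>

text \<open>In an ultrametric space every point of a ball is a centre of it; here the ball is the
  unit ball Z_p.\<close>

lemma padic_integers_dist_le_1:
  assumes p: "prime p" and Z: "Z \<in> padic_integers p"
  shows "Y \<in> padic_integers p \<longleftrightarrow> Y \<in> carrier (padic_ring p) \<and> padic_dist p Y Z \<le> 1"
proof -
  let ?O = "padic_of_rat p 0"
  have Z': "Z \<in> carrier (padic_ring p)" "padic_dist p Z ?O \<le> 1"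
    using Z by (auto simp: padic_integers_dist[OF p])
  have "padic_dist p Y Z \<le> 1" if "Y \<in> carrier (padic_ring p)" "padic_dist p Y ?O \<le> 1"
    using padic_dist_ultrametric[OF p that(1) padic_of_rat_carrier[of p 0] Z'(1)] Z'(2) that(2)
    by (simp add: padic_dist_commute[OF p, of ?O])
  moreover have "padic_dist p Y ?O \<le> 1" if "Y \<in> carrier (padic_ring p)" "padic_dist p Y Z \<le> 1"
    using padic_dist_ultrametric[OF p that(1) Z'(1) padic_of_rat_carrier[of p 0]] Z'(2) that(2) by simp
  ultimately show ?thesis by (auto simp: padic_integers_dist[OF p])
qed

definition rat_finite_adele :: "rat \<Rightarrow> nat \<Rightarrow> padic" where
  "rat_finite_adele q = (\<lambda>p\<in>{p. prime p}. padic_of_rat p q)"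

lemma adele_of_rat_eq: "adele_of_rat q = (of_rat q, rat_finite_adele q)"
  by (simp add: adele_of_rat_def rat_finite_adele_def)

lemma rat_finite_adele_in [simp]: "rat_finite_adele q \<in> finite_adeles"
  using adele_of_rat_carrier[of q] by (simp add: adele_of_rat_eq adele_ring_def)

lemma rat_finite_adele_apply: "prime p \<Longrightarrow> rat_finite_adele q p = padic_of_rat p q"
  by (simp add: rat_finite_adele_def)

lemma rat_finite_adele_0: "rat_finite_adele 0 = \<zero>\<^bsub>finite_adele_ring\<^esub>"
  by (auto simp: rat_finite_adele_def finite_adele_ring_def padic_of_rat_0 intro!: restrict_ext)

definition finite_adele_shift :: "(nat \<Rightarrow> padic) \<Rightarrow> rat \<Rightarrow> nat \<Rightarrow> padic" where
  "finite_adele_shift z q = z \<oplus>\<^bsub>finite_adele_ring\<^esub> rat_finite_adele q"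

lemma finite_adele_shift_in [simp]: "z \<in> finite_adeles \<Longrightarrow> finite_adele_shift z q \<in> finite_adeles"
  using cring.cring_simprules(1)[OF cring_finite_adele_ring, of z "rat_finite_adele q"]
  by (simp add: finite_adele_shift_def) (simp add: finite_adele_ring_def)

lemma finite_adele_shift_apply:
  "prime p \<Longrightarrow> finite_adele_shift z q p = z p \<oplus>\<^bsub>padic_ring p\<^esub> padic_of_rat p q"
  by (simp add: finite_adele_shift_def finite_adele_ring_def rat_finite_adele_def)

lemma finite_adele_shift_rat: "finite_adele_shift (rat_finite_adele q) r = rat_finite_adele (q + r)"
  using adele_of_rat_add[of q r]
  by (simp add: finite_adele_shift_def adele_of_rat_eq adele_ring_def)

text \<open>For N > 0 this is the coset z + N Zhat. Since |N|_p < 1 only at the primes dividing N, a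
  single natural number records the radii at all primes.\<close>

definition finite_adele_nhd :: "nat \<Rightarrow> (nat \<Rightarrow> padic) \<Rightarrow> (nat \<Rightarrow> padic) set" where
  "finite_adele_nhd N z =
     {y \<in> finite_adeles. \<forall>p. prime p \<longrightarrow> padic_dist p (y p) (z p) \<le> padic_abs p (of_nat N)}"

lemma finite_adele_nhd_subset: "finite_adele_nhd N z \<subseteq> finite_adeles"
  by (auto simp: finite_adele_nhd_def)

lemma finite_adele_nhd_self:
  assumes "z \<in> finite_adeles" shows "z \<in> finite_adele_nhd N z"
proof -
  have "padic_dist p (z p) (z p) = 0" if "prime p" for p
    using Metric_space.zero[OF Metric_space_padic[OF that]] finite_adelesD(1)[OF assms that] by blast
  then show ?thesis using assms by (simp add: finite_adele_nhd_def)
qed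

lemma finite_adele_nhd_sym:
  "y \<in> finite_adele_nhd N z \<Longrightarrow> z \<in> finite_adeles \<Longrightarrow> z \<in> finite_adele_nhd N y"
  by (auto simp: finite_adele_nhd_def padic_dist_commute)

text \<open>Radii do not add up, by the ultrametric inequality, so nearness at level N behaves like
  a congruence.\<close>

lemma finite_adele_nhd_trans:
  assumes "x \<in> finite_adele_nhd N y" "y \<in> finite_adele_nhd N z" "z \<in> finite_adeles"
  shows "x \<in> finite_adele_nhd N z"
proof -
  have "padic_dist p (x p) (z p) \<le> padic_abs p (of_nat N)" if p: "prime p" for p
    using padic_dist_ultrametric[OF p, of "x p" "y p" "z p"] assms p finite_adelesD(1)[OF _ p]
    unfolding finite_adele_nhd_def by (simp, meson order_trans max.boundedI)
  then show ?thesis using assms(1) by (simp add: finite_adele_nhd_def)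
qed

lemma padic_abs_of_nat_mult_le: "prime p \<Longrightarrow> padic_abs p (of_nat (M * N)) \<le> padic_abs p (of_nat N)"
  by (simp add: padic_abs_mult padic_abs_of_nat_le_1 mult_left_le_one_le)

lemma finite_adele_nhd_dvd:
  assumes "N dvd M" shows "finite_adele_nhd M z \<subseteq> finite_adele_nhd N z"
proof -
  obtain k where "M = k * N" using assms by (metis dvd_def mult.commute)
  then have "padic_abs p (of_nat M) \<le> padic_abs p (of_nat N)" if "prime p" for p
    using padic_abs_of_nat_mult_le[OF that] by blast
  then show ?thesis
    unfolding finite_adele_nhd_def by (blast intro: order_trans)
qed

lemma finite_adele_nhd_shift:
  assumes "y \<in> finite_adele_nhd N z" "z \<in> finite_adeles"
  shows "finite_adele_shift y q \<in> finite_adele_nhd N (finite_adele_shift z q)"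
  using assms
  by (auto simp: finite_adele_nhd_def finite_adele_shift_apply padic_dist_add_right finite_adelesD(1))

text \<open>Q meets N Zhat in N Z: the quotient (a - b)/N is integral at every prime, hence an
  integer. This is where the adelic level N becomes a period on the real line.\<close>

lemma rat_finite_adele_nhd_iff:
  assumes "N > 0"
  shows "rat_finite_adele a \<in> finite_adele_nhd N (rat_finite_adele b) \<longleftrightarrow>
         (\<exists>k::int. a - b = of_int k * of_nat N)"
proof
  assume "rat_finite_adele a \<in> finite_adele_nhd N (rat_finite_adele b)"
  then have le: "padic_abs p (a - b) \<le> padic_abs p (of_nat N)" if "prime p" for p
    using that by (auto simp: finite_adele_nhd_def rat_finite_adele_apply padic_dist_of_rat)
  have "padic_abs p ((a - b) / of_nat N) \<le> 1" if "prime p" for p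
    using le[OF that] padic_abs_of_nat_pos[OF that assms] by (simp add: padic_abs_divide[OF that])
  then have "(a - b) / of_nat N \<in> \<int>" by (rule rat_Ints_if_padic_integral)
  then obtain k where "(a - b) / of_nat N = of_int k" by (elim Ints_cases)
  then show "\<exists>k::int. a - b = of_int k * of_nat N"
    using assms by (auto simp: field_simps)
next
  assume "\<exists>k::int. a - b = of_int k * of_nat N"
  then obtain k :: int where k: "a - b = of_int k * of_nat N" by blast
  have "padic_abs p (a - b) \<le> padic_abs p (of_nat N)" if "prime p" for p
    by (simp add: k padic_abs_mult[OF that] padic_abs_of_int_le_1[OF that] mult_left_le_one_le)
  then show "rat_finite_adele a \<in> finite_adele_nhd N (rat_finite_adele b)"
    by (simp add: finite_adele_nhd_def rat_finite_adele_apply padic_dist_of_rat)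
qed

text \<open>At every prime that does not divide N and at which z is integral, the ball is Z_p
  itself, so the set is one of the boxes that generate the topology.\<close>

lemma openin_finite_adele_nhd:
  assumes N: "N > 0" and z: "z \<in> finite_adeles"
  shows "openin finite_adele_topology (finite_adele_nhd N z)"
proof -
  define U where "U p = {Y \<in> carrier (padic_ring p). padic_dist p Y (z p) \<le> padic_abs p (of_nat N)}" for p
  define B where "B = {p. prime p \<and> z p \<notin> padic_integers p} \<union> {p. p dvd N}"
  have fin: "finite B" using finite_adelesD(2)[OF z] N by (simp add: B_def)
  have U: "U p = padic_integers p" if p: "prime p" and "p \<notin> B" for p
  proof -
    have zp: "z p \<in> padic_integers p" using that by (simp add: B_def)
    have N1: "padic_abs p (of_nat N) = 1"
      using padic_abs_of_int_coprime[OF p, of "int N"] that by (simp add: B_def)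
    show ?thesis
      using padic_integers_dist_le_1[OF p zp] by (auto simp: U_def N1)
  qed
  have fin': "finite {p. prime p \<and> U p \<noteq> padic_integers p}"
    by (rule finite_subset[OF _ fin]) (use U in auto)
  have op: "openin (padic_topology p) (U p)" if "prime p" for p
    unfolding U_def by (intro openin_padic_cball that finite_adelesD(1)[OF z] padic_abs_of_nat_pos N)
  have open_PiE: "openin finite_adele_topology (\<Pi>\<^sub>E p\<in>{p. prime p}. U p)"
    unfolding finite_adele_topology_def
    by (rule topology_generated_by_Basis) (use op fin' in blast)
  have "(\<Pi>\<^sub>E p\<in>{p. prime p}. U p) \<subseteq> finite_adeles"
    using openin_subset[OF open_PiE] by (simp add: topspace_finite_adele_topology)
  moreover have "y p \<in> U p" if "y \<in> (\<Pi>\<^sub>E p\<in>{p. prime p}. U p)" "prime p" for y p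
    by (rule PiE_mem[OF that(1)]) (simp add: that(2))
  ultimately have "(\<Pi>\<^sub>E p\<in>{p. prime p}. U p) \<subseteq> finite_adele_nhd N z"
    unfolding finite_adele_nhd_def U_def by blast
  moreover have "finite_adele_nhd N z \<subseteq> (\<Pi>\<^sub>E p\<in>{p. prime p}. U p)"
  proof (intro subsetI PiE_I)
    fix y p assume y: "y \<in> finite_adele_nhd N z"
    then show "y p \<in> U p" if "p \<in> {p. prime p}"
      using that finite_adelesD(1)[of y p] by (simp add: finite_adele_nhd_def U_def)
    show "y p = undefined" if "p \<notin> {p. prime p}"
      using y that finite_adelesD(3)[of y] by (simp add: finite_adele_nhd_def extensional_def)
  qed
  ultimately have "finite_adele_nhd N z = (\<Pi>\<^sub>E p\<in>{p. prime p}. U p)" by simp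
  then show ?thesis using open_PiE by simp
qed

text \<open>Induction over the generation of open sets: an intersection is served by the product of
  the two levels, a box by a product of prime powers.\<close>

lemma finite_adele_nhd_basis:
  assumes "openin finite_adele_topology W" "z \<in> W"
  obtains N where "N > 0" "finite_adele_nhd N z \<subseteq> W"
proof -
  have "\<exists>N>0. finite_adele_nhd N z \<subseteq> W"
    using assms unfolding finite_adele_topology_def openin_topology_generated_by_iff
  proof (induction arbitrary: z)
    case (Int a b)
    then obtain M N where "M > 0" "finite_adele_nhd M z \<subseteq> a" "N > 0" "finite_adele_nhd N z \<subseteq> b"
      by (metis IntE)
    then show ?case
      using finite_adele_nhd_dvd[of M "M * N" z] finite_adele_nhd_dvd[of N "M * N" z]
      by (intro exI[of _ "M * N"]) auto
  next
    case (UN K)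
    from UN.prems obtain k where k: "k \<in> K" "z \<in> k" by blast
    from UN.IH[OF k] k(1) show ?case by blast
  next
    case (Basis s)
    then obtain U where s: "s = (\<Pi>\<^sub>E p\<in>{p. prime p}. U p)"
      and U: "\<And>p. prime p \<Longrightarrow> openin (padic_topology p) (U p)"
      and fin: "finite {p. prime p \<and> U p \<noteq> padic_integers p}" by blast
    define F where "F = {p. prime p \<and> U p \<noteq> padic_integers p}"
    have z: "z p \<in> U p" if "prime p" for p
      using PiE_mem[OF Basis.prems[unfolded s]] that by simp
    have "\<exists>k. \<forall>Y\<in>carrier (padic_ring p). padic_dist p Y (z p) \<le> 1 / real p ^ k \<longrightarrow> Y \<in> U p"
      if p: "prime p" for p
    proof -
      interpret Metric_space "carrier (padic_ring p)" "padic_dist p" by (rule Metric_space_padic[OF p])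
      obtain r where r: "r > 0" "mball (z p) r \<subseteq> U p"
        using U[OF p] z[OF p] unfolding padic_topology_def openin_mtopology by blast
      obtain k where "(1 / real p) ^ k < r"
        using real_arch_pow_inv[OF r(1), of "1 / real p"] prime_gt_1_nat[OF p] by auto
      moreover have "z p \<in> carrier (padic_ring p)"
        using openin_subset[OF U[OF p]] z[OF p] topspace_padic_topology[OF p] by blast
      ultimately show ?thesis
        using r(2) by (intro exI[of _ k]) (auto simp: power_one_over subset_iff commute)
    qed
    then obtain k where k: "\<And>p Y. prime p \<Longrightarrow> Y \<in> carrier (padic_ring p) \<Longrightarrow>
        padic_dist p Y (z p) \<le> 1 / real p ^ k p \<Longrightarrow> Y \<in> U p" by metis
    \<comment> \<open>At a prime in \<open>F\<close> this forces the radius down to 1/p^(k p). At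
      the others \<open>U p\<close> is Z_p, and the radius bound 1 that every N gives is enough
      because \<open>z p\<close> is integral there.\<close>
    define N where "N = (\<Prod>p\<in>F. p ^ k p)"
    have finF: "finite F" using fin by (simp add: F_def)
    have N: "N > 0" unfolding N_def F_def by (auto intro!: prod_pos dest: prime_gt_0_nat)
    have "y p \<in> U p" if y: "y \<in> finite_adele_nhd N z" and p: "prime p" for y p
    proof (cases "p \<in> F")
      case True
      then have "p ^ k p dvd N" unfolding N_def using finF by (rule dvd_prodI[rotated])
      then have "int p ^ k p dvd int N" by (metis int_dvd_int_iff of_nat_power)
      then have "padic_abs p (of_nat N) \<le> 1 / real p ^ k p"
        using padic_abs_of_int_dvd[OF p, of "k p" "int N"] by simp
      then show ?thesis
        using k[OF p, of "y p"] y p finite_adelesD(1)[of y p] unfolding finite_adele_nhd_def by (simp, meson order_trans)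
    next
      case False
      then have Up: "U p = padic_integers p" using p by (simp add: F_def)
      then have zp: "z p \<in> padic_integers p" using z[OF p] by simp
      have "padic_dist p (y p) (z p) \<le> 1" "y p \<in> carrier (padic_ring p)"
        using y p padic_abs_of_nat_le_1[OF p, of N] finite_adelesD(1)[of y p]
        unfolding finite_adele_nhd_def by (simp_all, meson order_trans)
      then show ?thesis
        using padic_integers_dist_le_1[OF p zp] by (simp add: Up)
    qed
    then have "finite_adele_nhd N z \<subseteq> s"
      unfolding s using finite_adele_nhd_subset finite_adelesD(3) by (simp add: PiE_iff subset_iff)
    then show ?case using N by blast
  qed auto
  then show ?thesis using that by blast
qed

text \<open>Dividing by N turns the required radius |N|_p into 1, the precision that
  \<open>rat_strong_approximation\<close> offers; the rational found is multiplied by N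
  afterwards.\<close>

lemma finite_adele_strong_approximation:
  assumes N: "N > 0" and z: "z \<in> finite_adeles"
  obtains q where "rat_finite_adele q \<in> finite_adele_nhd N z"
proof -
  \<comment> \<open>The primes dividing N are included, so that outside \<open>F\<close> the radius
    is 1 and integrality alone settles the bound.\<close>
  define F where "F = {p. prime p \<and> z p \<notin> padic_integers p} \<union> {p. prime p \<and> p dvd N}"
  have finF: "finite F"
    using finite_adelesD(2)[OF z] N by (auto simp: F_def intro: finite_subset[of _ "{p. p dvd N}"])
  have "\<exists>a. padic_dist p (z p) (padic_of_rat p a) < padic_abs p (of_nat N)" if p: "prime p" for p
    using padic_of_rat_dense[OF p finite_adelesD(1)[OF z p] padic_abs_of_nat_pos[OF p N]] by metis
  then obtain a where a: "\<And>p. prime p \<Longrightarrow> padic_dist p (z p) (padic_of_rat p (a p)) < padic_abs p (of_nat N)"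
    by metis
  obtain q where q: "\<And>p. p \<in> F \<Longrightarrow> padic_abs p (a p / of_nat N - q) \<le> 1"
    "\<And>p. prime p \<Longrightarrow> p \<notin> F \<Longrightarrow> padic_abs p q \<le> 1"
    using rat_strong_approximation[OF finF, of "\<lambda>p. a p / of_nat N"] by (auto simp: F_def)
  have "padic_dist p (padic_of_rat p (q * of_nat N)) (z p) \<le> padic_abs p (of_nat N)" if p: "prime p" for p
  proof (cases "p \<in> F")
    case True
    have "a p - q * of_nat N = (a p / of_nat N - q) * of_nat N" using N by (simp add: field_simps)
    then have "padic_abs p (a p - q * of_nat N) = padic_abs p (a p / of_nat N - q) * padic_abs p (of_nat N)"
      by (metis padic_abs_mult[OF p])
    also have "\<dots> \<le> padic_abs p (of_nat N)"
      using q(1)[OF True] by (simp add: mult_left_le_one_le)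
    finally have "padic_dist p (padic_of_rat p (a p)) (padic_of_rat p (q * of_nat N)) \<le> padic_abs p (of_nat N)"
      by (simp add: padic_dist_of_rat[OF p])
    then show ?thesis
      using a[OF p] padic_dist_ultrametric[OF p finite_adelesD(1)[OF z p] padic_of_rat_carrier[of p "a p"]
          padic_of_rat_carrier[of p "q * of_nat N"]]
      by (simp add: padic_dist_commute[OF p, of _ "z p"])
  next
    case False
    have zp: "z p \<in> padic_integers p" using False p by (simp add: F_def)
    have N1: "padic_abs p (of_nat N) = 1"
      using padic_abs_of_int_coprime[OF p, of "int N"] False p by (simp add: F_def)
    have "padic_of_rat p (q * of_nat N) \<in> padic_integers p"
      using q(2)[OF p False] by (simp add: padic_of_rat_in_integers[OF p] padic_abs_mult[OF p] N1)
    then show ?thesis using padic_integers_dist_le_1[OF p zp] by (simp add: N1)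
  qed
  then have "rat_finite_adele (q * of_nat N) \<in> finite_adele_nhd N z"
    by (simp add: finite_adele_nhd_def rat_finite_adele_apply)
  then show ?thesis using that by blast
qed

text \<open>Exhibits Zhat as a full product, so that Tychonoff applies.\<close>

lemma finite_adele_integers_eq:
  "finite_adele_nhd 1 (rat_finite_adele 0) = (\<Pi>\<^sub>E p\<in>{p. prime p}. padic_integers p)" (is "?L = ?R")
proof
  show "?L \<subseteq> ?R"
  proof (intro subsetI PiE_I)
    fix y p assume y: "y \<in> ?L"
    then show "y p \<in> padic_integers p" if "p \<in> {p. prime p}"
      using that finite_adelesD(1)[of y p]
      by (simp add: finite_adele_nhd_def rat_finite_adele_apply padic_integers_dist)
    show "y p = undefined" if "p \<notin> {p. prime p}"
      using y that finite_adelesD(3)[of y] by (simp add: finite_adele_nhd_def extensional_def)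
  qed
  show "?R \<subseteq> ?L"
  proof
    fix y assume y: "y \<in> ?R"
    then have "finite {p. prime p \<and> y p \<notin> padic_integers p}"
      by (auto simp: PiE_iff intro: finite_subset[of _ "{}"])
    with y have "y \<in> finite_adeles"
      by (auto simp: finite_adeles_def PiE_iff padic_integers_dist)
    with y show "y \<in> ?L"
      by (auto simp: finite_adele_nhd_def rat_finite_adele_def PiE_iff padic_integers_dist)
  qed
qed

text \<open>Tychonoff makes the product of the Z_p compact. Its identity map into the restricted
  product is continuous, because a generating box meets it in a box that is a proper part at
  finitely many primes only.\<close>

lemma compactin_finite_adele_integers:
  "compactin finite_adele_topology (finite_adele_nhd 1 (rat_finite_adele 0))"
proof -
  let ?P = "{p::nat. prime p}"
  define T where "T = product_topology (\<lambda>p. subtopology (padic_topology p) (padic_integers p)) ?P"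
  have sub: "padic_integers p \<subseteq> topspace (padic_topology p)" if "prime p" for p
    using openin_subset[OF openin_padic_integers[OF that]] .
  have top: "topspace T = (\<Pi>\<^sub>E p\<in>?P. padic_integers p)"
    unfolding T_def topspace_product_topology
    by (rule PiE_cong) (use sub in auto)
  have comp: "compactin T (topspace T)"
  proof -
    have "compact_space T"
      unfolding T_def compact_space_product_topology
      using compactin_padic_integers compact_space_subtopology by blast
    then show ?thesis by (simp add: compact_space_def)
  qed
  have "continuous_map T finite_adele_topology (\<lambda>x. x)"
    unfolding finite_adele_topology_def
  proof (rule continuous_on_generated_topo)
    fix W assume "W \<in> {(\<Pi>\<^sub>E p\<in>{p. prime p}. U p) | U.
          (\<forall>p. prime p \<longrightarrow> openin (padic_topology p) (U p)) \<and>
          finite {p. prime p \<and> U p \<noteq> padic_integers p}}"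
    then obtain U where W: "W = (\<Pi>\<^sub>E p\<in>?P. U p)"
      and U: "\<And>p. prime p \<Longrightarrow> openin (padic_topology p) (U p)"
      and fin: "finite {p. prime p \<and> U p \<noteq> padic_integers p}" by blast
    have eq: "(\<lambda>x. x) -` W \<inter> topspace T = (\<Pi>\<^sub>E p\<in>?P. U p \<inter> padic_integers p)"
      unfolding top W by (auto simp: PiE_iff)
    have "finite {p \<in> ?P. U p \<inter> padic_integers p \<noteq> topspace (subtopology (padic_topology p) (padic_integers p))}"
      by (rule finite_subset[OF _ fin]) (use sub in auto)
    then show "openin T ((\<lambda>x. x) -` W \<inter> topspace T)"
      unfolding eq unfolding T_def openin_PiE_gen using U
      by (auto simp: openin_subtopology)
  next
    show "(\<lambda>x. x) ` topspace T \<subseteq> \<Union>{(\<Pi>\<^sub>E p\<in>{p. prime p}. U p) | U.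
          (\<forall>p. prime p \<longrightarrow> openin (padic_topology p) (U p)) \<and>
          finite {p. prime p \<and> U p \<noteq> padic_integers p}}"
    proof -
      have "(\<Pi>\<^sub>E p\<in>?P. padic_integers p) \<in> {(\<Pi>\<^sub>E p\<in>{p. prime p}. U p) | U.
          (\<forall>p. prime p \<longrightarrow> openin (padic_topology p) (U p)) \<and>
          finite {p. prime p \<and> U p \<noteq> padic_integers p}}"
        using openin_padic_integers by (intro CollectI exI[of _ padic_integers]) auto
      then show ?thesis unfolding top by (simp add: Sup_upper)
    qed
  qed
  from image_compactin[OF comp this] show ?thesis
    unfolding finite_adele_integers_eq by (simp add: top)
qed

section \<open>Continuous functions on \<open>\<bbbA>/\<rat>\<close>\<close>

lemma topspace_adele_topology_eq: "topspace adele_topology = UNIV \<times> finite_adeles"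
  by (simp add: topspace_adele_topology adele_ring_def)

lemma adele_shift_eq:
  "(x + of_rat q, finite_adele_shift z q) = (x, z) \<oplus>\<^bsub>adele_ring\<^esub> adele_of_rat q"
  by (simp add: finite_adele_shift_def adele_ring_def adele_of_rat_eq)

lemma adele_class_eq_UN: "adele_class a = (\<Union>q. {adele_of_rat q \<oplus>\<^bsub>adele_ring\<^esub> a})"
  by (auto simp: adele_class_def a_r_coset_def')

lemma adele_class_shift:
  assumes z: "z \<in> finite_adeles"
  shows "adele_class (x + of_rat q, finite_adele_shift z q) = adele_class (x, z)"
proof -
  interpret A: cring adele_ring by (rule cring_adele_ring)
  have car: "(x, z) \<in> carrier adele_ring" using z by (simp add: adele_ring_def)
  have eq: "adele_of_rat r \<oplus>\<^bsub>adele_ring\<^esub> ((x, z) \<oplus>\<^bsub>adele_ring\<^esub> adele_of_rat q)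
      = adele_of_rat (r + q) \<oplus>\<^bsub>adele_ring\<^esub> (x, z)" for r
    using A.a_assoc[OF adele_of_rat_carrier adele_of_rat_carrier car, of r q]
      A.a_comm[OF car adele_of_rat_carrier, of q] by (simp add: adele_of_rat_add)
  have "adele_of_rat r \<oplus>\<^bsub>adele_ring\<^esub> (x, z) \<in> adele_class ((x, z) \<oplus>\<^bsub>adele_ring\<^esub> adele_of_rat q)" for r
    unfolding adele_class_eq_UN eq by (intro UN_I[of "r - q"]) auto
  then show ?thesis
    unfolding adele_shift_eq adele_class_eq_UN eq by auto
qed

lemma adele_class_eqE:
  assumes "adele_class (x, z) = adele_class (y, w)" "z \<in> finite_adeles" "w \<in> finite_adeles"
  obtains q where "y = x + of_rat q" "w = finite_adele_shift z q"
proof -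
  interpret A: cring adele_ring by (rule cring_adele_ring)
  have car: "(x, z) \<in> carrier adele_ring" "(y, w) \<in> carrier adele_ring"
    using assms by (simp_all add: adele_ring_def)
  have "adele_of_rat 0 \<oplus>\<^bsub>adele_ring\<^esub> (y, w) = (y, w)"
    using adele_of_rat_add[of 0 0] adele_of_rat_carrier[of 0] car
    by (metis A.add.l_cancel_one' A.l_zero add_0)
  then have "(y, w) \<in> adele_class (x, z)"
    unfolding assms(1) adele_class_eq_UN[of "(y, w)"] by (intro UN_I[of 0]) auto
  then obtain q where "(y, w) = adele_of_rat q \<oplus>\<^bsub>adele_ring\<^esub> (x, z)"
    unfolding adele_class_eq_UN by blast
  then have "(y, w) = (x + of_rat q, finite_adele_shift z q)"
    using A.a_comm[OF car(1) adele_of_rat_carrier, of q] by (simp add: adele_shift_eq)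
  then show ?thesis using that by simp
qed

text \<open>Strong approximation gives a rational translate with integral finite part. A further
  integer translation brings the real part into [0,1] and keeps the finite part integral.\<close>

lemma adele_reduction:
  fixes x :: real
  assumes z: "z \<in> finite_adeles"
  obtains q where "x + of_rat q \<in> {0..1}"
    "finite_adele_shift z q \<in> finite_adele_nhd 1 (rat_finite_adele 0)"
proof -
  obtain r where r: "rat_finite_adele r \<in> finite_adele_nhd 1 z"
    using finite_adele_strong_approximation[OF _ z, of 1] by auto
  define k where "k = - \<lfloor>x - of_rat r\<rfloor>"
  have "rat_finite_adele (of_int k) \<in> finite_adele_nhd 1 (finite_adele_shift z (of_int k - r))"
    using finite_adele_nhd_shift[OF r z, of "of_int k - r"] by (simp add: finite_adele_shift_rat)
  then have "finite_adele_shift z (of_int k - r) \<in> finite_adele_nhd 1 (rat_finite_adele (of_int k))"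
    by (rule finite_adele_nhd_sym) (simp add: z)
  moreover have "rat_finite_adele (of_int k) \<in> finite_adele_nhd 1 (rat_finite_adele 0)"
    by (subst rat_finite_adele_nhd_iff) auto
  ultimately have "finite_adele_shift z (of_int k - r) \<in> finite_adele_nhd 1 (rat_finite_adele 0)"
    by (rule finite_adele_nhd_trans) simp
  moreover have "x + of_rat (of_int k - r) \<in> {0..1}"
  proof -
    have "of_rat (of_int k - r) = real_of_int k - of_rat r" by (simp add: of_rat_diff)
    then show ?thesis unfolding k_def atLeastAtMost_iff by linarith
  qed
  ultimately show ?thesis using that by blast
qed

lemma compactin_adele_box:
  "compactin adele_topology ({0..1} \<times> finite_adele_nhd 1 (rat_finite_adele 0))"
  unfolding adele_topology_def compactin_Times
  using compactin_finite_adele_integers by simp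

lemma topspace_adele_class_topology:
  "topspace adele_class_topology = adele_class ` (UNIV \<times> finite_adeles)"
  using quotient_imp_surjective_map[OF quotient_map_adele_class]
  by (simp add: topspace_adele_topology_eq)

text \<open>By \<open>adele_reduction\<close>, the compact box [0,1] x Zhat maps onto the
  quotient.\<close>

lemma compact_space_adele_class_topology: "compact_space adele_class_topology"
proof -
  let ?K = "{0..1::real} \<times> finite_adele_nhd 1 (rat_finite_adele 0)"
  have "compactin adele_class_topology (adele_class ` ?K)"
    by (rule image_compactin[OF compactin_adele_box quotient_imp_continuous_map[OF quotient_map_adele_class]])
  moreover have "topspace adele_class_topology = adele_class ` ?K"
  proof
    show "adele_class ` ?K \<subseteq> topspace adele_class_topology"
      using finite_adele_nhd_subset unfolding topspace_adele_class_topology by blast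
    show "topspace adele_class_topology \<subseteq> adele_class ` ?K"
    proof
      fix \<xi> assume "\<xi> \<in> topspace adele_class_topology"
      then obtain x z where z: "z \<in> finite_adeles" and \<xi>: "\<xi> = adele_class (x, z)"
        unfolding topspace_adele_class_topology by auto
      obtain q where "x + of_rat q \<in> {0..1}"
        "finite_adele_shift z q \<in> finite_adele_nhd 1 (rat_finite_adele 0)"
        using adele_reduction[OF z] by blast
      then show "\<xi> \<in> adele_class ` ?K"
        unfolding \<xi> adele_class_shift[OF z, of x q, symmetric] by (intro imageI SigmaI)
    qed
  qed
  ultimately show ?thesis by (simp add: compact_space_def)
qed

lemma adele_class_in: "z \<in> finite_adeles \<Longrightarrow> adele_class (x, z) \<in> topspace adele_class_topology"
  unfolding topspace_adele_class_topology by blast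

lemma continuous_map_comp_adele_class:
  assumes "continuous_map adele_class_topology T f"
  shows "continuous_map adele_topology T (\<lambda>a. f (adele_class a))"
  using continuous_map_compose[OF quotient_imp_continuous_map[OF quotient_map_adele_class] assms]
  by (simp add: o_def)

text \<open>
  By compactness of \<open>[0,1] \<times> Z\<close>, with \<open>Z\<close> the integral finite adeles, and since every adele
  has a rational translate in that box.
\<close>

lemma adele_function_uniform:
  fixes f :: "adele set \<Rightarrow> complex"
  assumes f: "continuous_map adele_class_topology euclidean f" and e: "e > 0"
  obtains N where "N > 0"
    "\<And>x z y. z \<in> finite_adeles \<Longrightarrow> y \<in> finite_adele_nhd N z \<Longrightarrow>
       norm (f (adele_class (x, y)) - f (adele_class (x, z))) < e"
proof -
  let ?Z = "finite_adele_nhd 1 (rat_finite_adele 0)"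
  define F where "F a = f (adele_class a)" for a
  have F: "continuous_map adele_topology euclidean F"
    unfolding F_def by (rule continuous_map_comp_adele_class[OF f])
  have "\<exists>U N. open U \<and> fst c \<in> U \<and> N > 0 \<and>
      (\<forall>x\<in>U. \<forall>y\<in>finite_adele_nhd N (snd c). dist (F c) (F (x, y)) < e / 2)"
    if c: "snd c \<in> finite_adeles" for c
  proof -
    have "openin (prod_topology euclideanreal finite_adele_topology)
        {a \<in> topspace adele_topology. F a \<in> ball (F c) (e / 2)}"
      using openin_continuous_map_preimage[OF F, of "ball (F c) (e / 2)"]
      by (simp add: adele_topology_def)
    moreover have "(fst c, snd c) \<in> {a \<in> topspace adele_topology. F a \<in> ball (F c) (e / 2)}"
      using c e by (simp add: topspace_adele_topology_eq mem_Times_iff)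
    ultimately obtain U V where U: "open U" "fst c \<in> U" and V: "openin finite_adele_topology V" "snd c \<in> V"
      and UV: "U \<times> V \<subseteq> {a \<in> topspace adele_topology. F a \<in> ball (F c) (e / 2)}"
      unfolding openin_prod_topology_alt open_openin[symmetric] by meson
    obtain N where "N > 0" "finite_adele_nhd N (snd c) \<subseteq> V"
      using finite_adele_nhd_basis[OF V] .
    then show ?thesis using U UV by (intro exI[of _ U] exI[of _ N]) auto
  qed
  then obtain U M where UM: "\<And>c. snd c \<in> finite_adeles \<Longrightarrow> open (U c) \<and> fst c \<in> U c \<and> M c > 0 \<and>
      (\<forall>x\<in>U c. \<forall>y\<in>finite_adele_nhd (M c) (snd c). dist (F c) (F (x, y)) < e / 2)"
    by metis
  define O' where "O' c = U c \<times> finite_adele_nhd (M c) (snd c)" for c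
  let ?K = "{0..1::real} \<times> ?Z"
  have K: "snd c \<in> finite_adeles" if "c \<in> ?K" for c
    using that finite_adele_nhd_subset by (auto simp: mem_Times_iff)
  have "openin adele_topology (O' c)" if "c \<in> ?K" for c
    unfolding O'_def adele_topology_def openin_prod_Times_iff
    using UM[OF K[OF that]] openin_finite_adele_nhd[OF _ K[OF that]] by simp
  moreover have "c \<in> O' c" if "c \<in> ?K" for c
    using UM[OF K[OF that]] finite_adele_nhd_self[OF K[OF that]] by (simp add: O'_def mem_Times_iff)
  ultimately have "\<And>W. W \<in> O' ` ?K \<Longrightarrow> openin adele_topology W" "?K \<subseteq> \<Union>(O' ` ?K)"
    by (blast, intro subsetI UN_I)
  from compactinD[OF compactin_adele_box this]
  obtain \<F> where "finite \<F>" "\<F> \<subseteq> O' ` ?K" "?K \<subseteq> \<Union>\<F>" by metis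
  then obtain C where C: "finite C" "C \<subseteq> ?K" "?K \<subseteq> \<Union>(O' ` C)"
    using finite_subset_image[of \<F> O' ?K] by metis
  \<comment> \<open>A common multiple of the levels in the finite subcover works at every
    centre.\<close>
  define N where "N = (\<Prod>c\<in>C. M c)"
  have N: "N > 0"
    unfolding N_def using UM K C(2) by (intro prod_pos) blast
  have box: "dist (F (x, y)) (F (x, z)) < e"
    if xz: "x \<in> {0..1}" "z \<in> ?Z" and y: "y \<in> finite_adele_nhd N z" for x z y
  proof -
    have "(x, z) \<in> ?K" using xz by simp
    then obtain c where c: "c \<in> C" "(x, z) \<in> O' c" using C(3) by blast
    then have cK: "snd c \<in> finite_adeles" using C(2) K by blast
    have z: "z \<in> finite_adele_nhd (M c) (snd c)" and x: "x \<in> U c" using c by (auto simp: O'_def)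
    have "M c dvd N" unfolding N_def by (rule dvd_prodI[OF C(1) c(1)])
    then have "y \<in> finite_adele_nhd (M c) z" using finite_adele_nhd_dvd y by blast
    then have "y \<in> finite_adele_nhd (M c) (snd c)" using z cK by (rule finite_adele_nhd_trans)
    then have "dist (F c) (F (x, y)) < e / 2" "dist (F c) (F (x, z)) < e / 2"
      using UM[OF cK] x z by auto
    then show ?thesis by (rule dist_triangle_half_r)
  qed
  have "norm (f (adele_class (x, y)) - f (adele_class (x, z))) < e"
    if z: "z \<in> finite_adeles" and y: "y \<in> finite_adele_nhd N z" for x z y
  proof -
    \<comment> \<open>The same q translates both arguments: the two values of f do not change, while
      (x, z) enters the box.\<close>
    obtain q where q: "x + of_rat q \<in> {0..1}" "finite_adele_shift z q \<in> ?Z"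
      using adele_reduction[OF z] by blast
    have "y \<in> finite_adeles" using y finite_adele_nhd_subset by blast
    then show ?thesis
      using box[OF q finite_adele_nhd_shift[OF y z]]
      by (simp add: F_def adele_class_shift z dist_norm)
  qed
  then show ?thesis using that N by blast
qed

section \<open>Restriction to the real line\<close>

lemma continuous_map_adele_real_line:
  assumes "z \<in> finite_adeles"
  shows "continuous_map euclideanreal adele_topology (\<lambda>x. (x, z))"
  unfolding adele_topology_def
  using assms by (intro continuous_map_pairedI) (auto simp: topspace_finite_adele_topology)

lemma adele_real_line_continuous:
  assumes "continuous_map adele_class_topology euclidean f" "z \<in> finite_adeles"
  shows "continuous_on UNIV (\<lambda>x. f (adele_class (x, z)))"
  using continuous_map_compose[OF continuous_map_adele_real_line[OF assms(2)]
      continuous_map_comp_adele_class[OF assms(1)]]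
  by (simp add: o_def)

text \<open>Translating diagonally by -kN returns the real coordinate to x and moves the finite
  coordinate from 0 to -kN, which lies in N Zhat.\<close>

lemma adele_real_line_uniform_period:
  fixes f :: "adele set \<Rightarrow> complex"
  assumes near: "\<And>x z y. z \<in> finite_adeles \<Longrightarrow> y \<in> finite_adele_nhd N z \<Longrightarrow>
       norm (f (adele_class (x, y)) - f (adele_class (x, z))) < e" and N: "N > 0"
  shows "norm (f (adele_class (x + of_int k * of_nat N, rat_finite_adele 0))
             - f (adele_class (x, rat_finite_adele 0))) < e"
proof -
  define r :: rat where "r = - (of_int k * of_nat N)"
  have "adele_class (x + of_int k * of_nat N, rat_finite_adele 0) = adele_class (x, rat_finite_adele r)"
    using adele_class_shift[of "rat_finite_adele 0" "x + of_int k * of_nat N" r]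
    by (simp add: finite_adele_shift_rat r_def of_rat_minus of_rat_mult)
  moreover have "rat_finite_adele r \<in> finite_adele_nhd N (rat_finite_adele 0)"
    unfolding rat_finite_adele_nhd_iff[OF N] by (intro exI[of _ "- k"]) (simp add: r_def)
  ultimately show ?thesis using near[of "rat_finite_adele 0" "rat_finite_adele r" x] by simp
qed

lemma pre_periodic_adele_real_line:
  assumes "continuous_map adele_class_topology circle f"
  shows "pre_periodic (\<lambda>x. f (adele_class (x, rat_finite_adele 0)))"
proof -
  have f: "continuous_map adele_class_topology euclidean f"
    and im: "\<And>\<xi>. \<xi> \<in> topspace adele_class_topology \<Longrightarrow> f \<xi> \<in> sphere 0 1"
    using assms by (auto simp: continuous_map_in_subtopology)
  have "\<exists>N::nat. N > 0 \<and> (\<forall>k::int. \<forall>x::real.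
      norm (f (adele_class (x + of_int k * of_nat N, rat_finite_adele 0))
          - f (adele_class (x, rat_finite_adele 0))) < e)" if e: "e > 0" for e
    using adele_function_uniform[OF f e] adele_real_line_uniform_period by metis
  moreover have "range (\<lambda>x. f (adele_class (x, rat_finite_adele 0))) \<subseteq> sphere 0 1"
    using im[OF adele_class_in[OF rat_finite_adele_in]] by blast
  ultimately show ?thesis
    unfolding pre_periodic_def using adele_real_line_continuous[OF f] by simp
qed

section \<open>Winding numbers on the real line\<close>

lemma circle_lift_iff_cis:
  "circle_lift h l \<longleftrightarrow> continuous_on UNIV l \<and> (\<forall>x. h x = cis (2 * pi * l x))"
  unfolding circle_lift_def cis_conv_exp by (auto simp: mult_ac)

lemma ex_circle_lift:
  assumes "continuous_on UNIV h" "range h \<subseteq> sphere 0 1"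
  obtains l where "circle_lift h l"
proof -
  have h1: "norm (h x) = 1" for x using assms(2) by (auto simp: image_subset_iff)
  then have "h x \<noteq> 0" for x by (metis norm_zero zero_neq_one)
  then obtain g where g: "continuous_on UNIV g" "\<And>x. h x = exp (g x)"
    using continuous_logarithm_on_contractible[OF assms(1)]
    by (metis UNIV_I contractible_UNIV)
  have "Re (g x) = 0" for x using h1[of x] by (simp add: g(2))
  then have eq: "g x = \<i> * of_real (Im (g x))" for x by (simp add: complex_eq_iff)
  have "circle_lift h (\<lambda>x. Im (g x) / (2 * pi))"
    unfolding circle_lift_iff_cis
  proof (intro conjI allI)
    show "continuous_on UNIV (\<lambda>x. Im (g x) / (2 * pi))"
      by (intro continuous_intros g) auto
    show "h x = cis (2 * pi * (Im (g x) / (2 * pi)))" for x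
      by (subst g(2), subst eq) (simp add: cis_conv_exp)
  qed
  then show ?thesis by (rule that)
qed

lemma norm_cis_minus_1: "norm (cis t - 1) = 2 * \<bar>sin (t / 2)\<bar>"
  using dist_exp_i_1[of t] by (simp add: cis_conv_exp)

text \<open>A chord has length 2 |sin (\<pi> d)| for d turns; below length 1 it subtends less than
  60 degrees, a sixth of a turn.\<close>

lemma cis_near_1_imp_near_int:
  assumes "norm (cis (2 * pi * d) - 1) < 1"
  obtains m :: int where "\<bar>d - of_int m\<bar> < 1 / 6"
proof -
  define m where "m = round d"
  define \<delta> where "\<delta> = d - of_int m"
  have \<delta>: "\<bar>\<delta>\<bar> \<le> 1 / 2"
    using of_int_round_abs_le[of d] by (simp add: \<delta>_def m_def abs_minus_commute)
  have "2 * pi * d = 2 * pi * \<delta> + 2 * pi * of_int m" by (simp add: \<delta>_def algebra_simps)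
  then have "cis (2 * pi * d) = cis (2 * pi * \<delta>)"
    by (simp add: cis_mult[symmetric])
  then have "\<bar>sin (pi * \<delta>)\<bar> < 1 / 2"
    using assms norm_cis_minus_1[of "2 * pi * \<delta>"] by simp
  moreover have "\<bar>sin (pi * \<delta>)\<bar> = sin (pi * \<bar>\<delta>\<bar>)"
  proof -
    have "0 \<le> sin (pi * \<bar>\<delta>\<bar>)"
      using \<delta> by (intro sin_ge_zero) (auto simp: mult_left_le)
    moreover have "\<bar>sin (pi * \<delta>)\<bar> = \<bar>sin (pi * \<bar>\<delta>\<bar>)\<bar>" by (cases "\<delta> \<ge> 0") auto
    ultimately show ?thesis by simp
  qed
  ultimately have lt: "sin (pi * \<bar>\<delta>\<bar>) < sin (pi / 6)" by (simp add: sin_30)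
  have "\<bar>\<delta>\<bar> < 1 / 6"
  proof (rule ccontr)
    assume "\<not> \<bar>\<delta>\<bar> < 1 / 6"
    then have "pi / 6 \<le> pi * \<bar>\<delta>\<bar>" by (simp add: field_simps)
    moreover have "pi * \<bar>\<delta>\<bar> \<le> pi * (1 / 2)" using \<delta> by (intro mult_left_mono) auto
    ultimately have "sin (pi / 6) \<le> sin (pi * \<bar>\<delta>\<bar>)"
      by (intro sin_monotone_2pi_le) (use pi_gt_zero in linarith)+
    then show False using lt by simp
  qed
  then show ?thesis using that[of m] by (simp add: \<delta>_def)
qed

text \<open>Since c is at most 1/2, D avoids all half-integers. Its range is connected, so it cannot
  pass from one integer to the next.\<close>

lemma continuous_near_int_imp_near_const:
  fixes D :: "real \<Rightarrow> real"
  assumes D: "continuous_on UNIV D" and near: "\<And>x. \<exists>m::int. \<bar>D x - of_int m\<bar> < c" and c: "c \<le> 1 / 2"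
  obtains m :: int where "\<And>x. \<bar>D x - of_int m\<bar> < c"
proof -
  have conn: "connected (range D)" by (intro connected_continuous_image D connected_UNIV)
  have gap: "m' \<le> m"
    if m: "\<bar>D x - of_int m\<bar> < c" and m': "\<bar>D y - of_int m'\<bar> < c" for x y and m m' :: int
  proof (rule ccontr)
    assume "\<not> m' \<le> m"
    then have "m + 1 \<le> m'" by simp
    then have "real_of_int m + 1 \<le> real_of_int m'" by linarith
    then have "D x \<le> of_int m + 1 / 2" "of_int m + 1 / 2 \<le> D y" using m m' c by linarith+
    then have "of_int m + 1 / 2 \<in> range D"
      using connectedD_interval[OF conn rangeI rangeI] by blast
    then obtain z where "D z = of_int m + 1 / 2" by (metis imageE)
    moreover obtain n :: int where "\<bar>D z - of_int n\<bar> < c" using near[of z] by blast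
    ultimately have "\<bar>of_int m + 1 / 2 - of_int n :: real\<bar> < 1 / 2" using c by simp
    then have "real_of_int n < real_of_int (m + 1)" "real_of_int m < real_of_int n"
      unfolding of_int_add of_int_1 by linarith+
    then have "n < m + 1" "m < n" by (simp_all only: of_int_less_iff)
    then show False by simp
  qed
  obtain m where m: "\<bar>D 0 - of_int m\<bar> < c" using near by blast
  have "\<bar>D x - of_int m\<bar> < c" for x
  proof -
    obtain m' :: int where m': "\<bar>D x - of_int m'\<bar> < c" using near by blast
    then have "m = m'" using gap[OF m m'] gap[OF m' m] by simp
    then show ?thesis using m' by simp
  qed
  then show ?thesis by (rule that)
qed

text \<open>As |g x| = 1, the quotient h/g is as close to 1 as h is to g, and l - k is a lift of
  h/g.\<close>

lemma circle_lift_diff_near_const: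
  assumes l: "circle_lift h l" and k: "circle_lift g k" and near: "\<And>x. norm (h x - g x) < 1"
  obtains m :: int where "\<And>x. \<bar>l x - k x - of_int m\<bar> < 1 / 6"
proof -
  have "\<exists>m::int. \<bar>l x - k x - of_int m\<bar> < 1 / 6" for x
  proof -
    have "cis (2 * pi * (l x - k x)) - 1 = (h x - g x) / g x"
      using l k by (simp add: circle_lift_iff_cis diff_divide_distrib cis_divide right_diff_distrib)
    moreover have "norm (g x) = 1" using k by (simp add: circle_lift_iff_cis)
    ultimately have "norm (cis (2 * pi * (l x - k x)) - 1) < 1"
      using near[of x] by (simp add: norm_divide)
    then show ?thesis using cis_near_1_imp_near_int by blast
  qed
  moreover have "continuous_on UNIV (\<lambda>x. l x - k x)"
    using l k by (intro continuous_intros) (auto simp: circle_lift_iff_cis)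
  ultimately show ?thesis
    using continuous_near_int_imp_near_const[of "\<lambda>x. l x - k x" "1 / 6"] that by auto
qed

lemma circle_lift_unique:
  assumes l: "circle_lift h l" and k: "circle_lift h k"
  obtains m :: int where "\<And>x. l x = k x + of_int m"
proof -
  have "\<exists>n::int. l x - k x = of_int n" for x
  proof -
    have "cis (2 * pi * l x) = cis (2 * pi * k x)" using l k by (metis circle_lift_iff_cis)
    then have "cis (2 * pi * (l x - k x)) = 1"
      by (simp add: right_diff_distrib cis_divide[symmetric])
    then have "cos (2 * pi * (l x - k x)) = 1" by (simp add: complex_eq_iff)
    then obtain n :: int where "2 * pi * (l x - k x) = of_int n * 2 * pi"
      using cos_one_2pi_int by blast
    then show ?thesis by auto
  qed
  note int = this
  have "continuous_on UNIV (\<lambda>x. l x - k x)"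
    using l k by (intro continuous_intros) (auto simp: circle_lift_iff_cis)
  moreover have "\<exists>m::int. \<bar>(l x - k x) - of_int m\<bar> < 1 / 2" for x
    using int[of x] by (metis abs_zero diff_self zero_less_divide_1_iff zero_less_numeral)
  ultimately obtain m :: int where m: "\<And>x. \<bar>l x - k x - of_int m\<bar> < 1 / 2"
    using continuous_near_int_imp_near_const[of "\<lambda>x. l x - k x" "1 / 2"] by auto
  have "l x = k x + of_int m" for x
  proof -
    obtain n :: int where n: "l x - k x = of_int n" using int by blast
    then have "\<bar>real_of_int (n - m)\<bar> < 1" using m[of x] by simp
    then have "n = m" by linarith
    then show ?thesis using n by simp
  qed
  then show ?thesis by (rule that)
qed

section \<open>Mean slopes of lifts\<close>

definition mean_slope :: "(real \<Rightarrow> real) \<Rightarrow> real \<Rightarrow> bool" where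
  "mean_slope l w \<longleftrightarrow> ((\<lambda>x. (l x - l (- x)) / (2 * x)) \<longlongrightarrow> w) at_top"

lemma mean_slope_diff:
  "mean_slope l w \<Longrightarrow> mean_slope k v \<Longrightarrow> mean_slope (\<lambda>x. l x - k x) (w - v)"
  unfolding mean_slope_def
  by (drule (1) tendsto_diff) (simp add: diff_divide_distrib[symmetric] algebra_simps)

lemma mean_slope_bounded:
  assumes "\<And>x. \<bar>l x\<bar> \<le> B"
  shows "mean_slope l 0"
  unfolding mean_slope_def
proof (rule Lim_null_comparison)
  show "\<forall>\<^sub>F x in at_top. norm ((l x - l (- x)) / (2 * x)) \<le> B * inverse x"
  proof (rule eventually_mono[OF eventually_gt_at_top[of 0]])
    fix x :: real assume x: "0 < x"
    have "\<bar>l x - l (- x)\<bar> \<le> 2 * B" using assms[of x] assms[of "- x"] by linarith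
    then show "norm ((l x - l (- x)) / (2 * x)) \<le> B * inverse x"
      using x by (simp add: field_simps)
  qed
  show "((\<lambda>x. B * inverse x) \<longlongrightarrow> 0) at_top"
    by (intro tendsto_mult_right_zero tendsto_inverse_0_at_top filterlim_ident)
qed

lemma mean_slope_linear: "mean_slope (\<lambda>x. c * x) c"
  unfolding mean_slope_def
  by (rule tendsto_eventually, rule eventually_mono[OF eventually_gt_at_top[of 0]])
    (simp add: field_simps)

lemma mean_slope_unique: "mean_slope l w \<Longrightarrow> mean_slope l v \<Longrightarrow> w = v"
  unfolding mean_slope_def by (rule tendsto_unique[OF trivial_limit_at_top_linorder])

lemma mean_slope_bounded_diff:
  assumes "mean_slope k w" "\<And>x. \<bar>l x - k x\<bar> \<le> B"
  shows "mean_slope l w"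
  using mean_slope_diff[OF assms(1) mean_slope_bounded[of "\<lambda>x. k x - l x" B]] assms(2)
  by (simp add: abs_minus_commute)

text \<open>
  The integers approximating \<open>l (x + k N) - l x\<close> are additive in \<open>k\<close>, since the errors are too
  small to add up to an integer.
\<close>

lemma circle_lift_almost_period:
  assumes l: "circle_lift h l" and N: "(N::nat) > 0"
    and near: "\<And>(k::nat) x. norm (h (x + of_nat k * of_nat N) - h x) < 1"
  obtains m :: int where
    "\<And>(k::nat) x. \<bar>l (x + of_nat k * of_nat N) - l x - of_nat k * of_int m\<bar> < 1 / 6"
    "mean_slope l (of_int m / of_nat N)"
proof -
  have lc: "continuous_on UNIV l" using l by (simp add: circle_lift_iff_cis)
  have "\<exists>m::int. \<forall>x. \<bar>l (x + of_nat k * of_nat N) - l x - of_int m\<bar> < 1 / 6" for k :: nat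
  proof -
    have "circle_lift (\<lambda>x. h (x + of_nat k * of_nat N)) (\<lambda>x. l (x + of_nat k * of_nat N))"
      using l unfolding circle_lift_iff_cis
      by (auto intro!: continuous_on_compose2[OF lc] continuous_on_add continuous_on_id continuous_on_const)
    from circle_lift_diff_near_const[OF this l near] show ?thesis by blast
  qed
  then obtain M :: "nat \<Rightarrow> int" where
    M: "\<And>k x. \<bar>l (x + of_nat k * of_nat N) - l x - of_int (M k)\<bar> < 1 / 6" by metis
  define m where "m = M 1"
  have Mk: "M k = of_nat k * m" for k
  proof (induction k)
    case 0
    have "\<bar>real_of_int (M 0)\<bar> < 1 / 6" using M[of 0 0] by simp
    then show ?case by simp
  next
    case (Suc k)
    have "l (0 + of_nat (Suc k) * of_nat N) = l (of_nat k * of_nat N + of_nat 1 * of_nat N)"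
      by (simp add: algebra_simps)
    then have "\<bar>real_of_int (M (Suc k) - M k - m)\<bar> < 1"
      using M[where x = 0 and k = "Suc k"] M[where x = 0 and k = k]
        M[where x = "of_nat k * of_nat N" and k = 1]
      unfolding m_def of_int_diff add_0 by linarith
    then have "M (Suc k) = M k + m" by linarith
    then show ?case using Suc by (simp add: algebra_simps)
  qed
  have m: "\<bar>l (x + of_nat k * of_nat N) - l x - of_nat k * of_int m\<bar> < 1 / 6" for k :: nat and x
    using M[of x k] by (simp add: Mk)
  \<comment> \<open>Without its linear trend the lift moves by less than 1/6 under multiples of N,
    so a bound on [0,N], which compactness gives, controls it everywhere.\<close>
  define g where "g x = l x - of_int m / of_nat N * x" for x
  have gk: "\<bar>g (x + of_nat k * of_nat N) - g x\<bar> < 1 / 6" for k :: nat and x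
  proof -
    have "g (x + of_nat k * of_nat N) - g x = l (x + of_nat k * of_nat N) - l x - of_nat k * of_int m"
      using N by (simp add: g_def field_simps)
    then show ?thesis using m by simp
  qed
  have "compact (g ` {0..real N})"
    unfolding g_def by (intro compact_continuous_image continuous_intros continuous_on_subset[OF lc]) auto
  then obtain B where B: "\<And>x. x \<in> {0..real N} \<Longrightarrow> \<bar>g x\<bar> \<le> B"
    using compact_imp_bounded[THEN bounded_iff[THEN iffD1]] by (metis imageI real_norm_def)
  have "\<bar>g x\<bar> \<le> B + 1" for x
  proof -
    define k where "k = \<lfloor>x / real N\<rfloor>"
    define r where "r = x - of_int k * of_nat N"
    have N': "real N > 0" using N by simp
    have "of_int k \<le> x / real N" "x / real N < of_int k + 1" unfolding k_def by linarith+
    then have "of_int k * real N \<le> x" "x < (of_int k + 1) * real N"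
      using N' by (simp_all add: pos_le_divide_eq pos_divide_less_eq)
    then have r: "\<bar>g r\<bar> \<le> B" by (intro B) (simp add: r_def algebra_simps)
    show ?thesis
    proof (cases "k \<ge> 0")
      case True
      then have "x = r + of_nat (nat k) * of_nat N" by (simp add: r_def)
      then have "\<bar>g x - g r\<bar> < 1 / 6" using gk by metis
      then show ?thesis using r by linarith
    next
      case False
      \<comment> \<open>The estimate covers natural multiples of N only, so for negative k the shift
        runs from x to its representative r.\<close>
      then have "r = x + of_nat (nat (- k)) * of_nat N" by (simp add: r_def)
      then have "\<bar>g r - g x\<bar> < 1 / 6" using gk by metis
      then show ?thesis using r by linarith
    qed
  qed
  then have "mean_slope l (of_int m / of_nat N)"
    by (intro mean_slope_bounded_diff[OF mean_slope_linear]) (simp add: g_def)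
  then show ?thesis using that m by blast
qed

lemma pre_periodic_mean_slope:
  assumes "pre_periodic h"
  obtains l w where "circle_lift h l" "mean_slope l w"
proof -
  obtain l where l: "circle_lift h l"
    using assms ex_circle_lift unfolding pre_periodic_def by blast
  obtain N :: nat where "N > 0" and N: "\<And>(k::int) x. norm (h (x + of_int k * of_nat N) - h x) < 1"
    using assms unfolding pre_periodic_def by (meson zero_less_one)
  have "norm (h (x + of_nat k * of_nat N) - h x) < 1" for k :: nat and x
    using N[of x "int k"] by simp
  with l \<open>N > 0\<close> show ?thesis using circle_lift_almost_period[of h l N] that by metis
qed

text \<open>Any two lifts differ by an integer constant, which the mean slope does not see, so the
  definite description denotes w.\<close>

lemma gen_winding_number_eqI:
  assumes "pre_periodic h" "circle_lift h l" "mean_slope l w"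
  shows "gen_winding_number h = w"
  unfolding gen_winding_number_def mean_slope_def[symmetric]
proof (rule the_equality)
  show "pre_periodic h \<and> (\<exists>l. circle_lift h l \<and> mean_slope l w)" using assms by blast
  fix v assume "pre_periodic h \<and> (\<exists>l. circle_lift h l \<and> mean_slope l v)"
  then obtain k where k: "circle_lift h k" "mean_slope k v" by blast
  obtain m :: int where "\<And>x. l x = k x + of_int m" using circle_lift_unique[OF assms(2) k(1)] by blast
  then have "mean_slope l v"
    by (intro mean_slope_bounded_diff[OF k(2), of _ "\<bar>of_int m\<bar>"]) simp
  then show "v = w" using mean_slope_unique assms(3) by blast
qed

lemma gen_winding_number_divide:
  assumes f: "pre_periodic f" and g: "pre_periodic g" and fg: "pre_periodic (\<lambda>x. f x / g x)"
  shows "gen_winding_number (\<lambda>x. f x / g x) = gen_winding_number f - gen_winding_number g"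
proof -
  obtain l w where l: "circle_lift f l" "mean_slope l w" using pre_periodic_mean_slope[OF f] .
  obtain k v where k: "circle_lift g k" "mean_slope k v" using pre_periodic_mean_slope[OF g] .
  have "circle_lift (\<lambda>x. f x / g x) (\<lambda>x. l x - k x)"
    using l(1) k(1) unfolding circle_lift_iff_cis
    by (auto simp: cis_divide right_diff_distrib intro!: continuous_intros)
  then show ?thesis
    using gen_winding_number_eqI[OF fg _ mean_slope_diff[OF l(2) k(2)]]
      gen_winding_number_eqI[OF f l] gen_winding_number_eqI[OF g k] by simp
qed

text \<open>The two lifts stay at bounded distance from each other, which forces equal mean
  slopes.\<close>

lemma gen_winding_number_near:
  assumes f: "pre_periodic f" and g: "pre_periodic g" and near: "\<And>x. norm (f x - g x) < 1"
  shows "gen_winding_number f = gen_winding_number g"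
proof -
  obtain l w where l: "circle_lift f l" "mean_slope l w" using pre_periodic_mean_slope[OF f] .
  obtain k v where k: "circle_lift g k" "mean_slope k v" using pre_periodic_mean_slope[OF g] .
  obtain m :: int where m: "\<And>x. \<bar>l x - k x - of_int m\<bar> < 1 / 6"
    using circle_lift_diff_near_const[OF l(1) k(1) near] by blast
  have "\<bar>l x - k x\<bar> \<le> \<bar>of_int m\<bar> + 1" for x using m[of x] by linarith
  then have "mean_slope l v" by (rule mean_slope_bounded_diff[OF k(2)])
  then show ?thesis
    using gen_winding_number_eqI[OF f l(1)] gen_winding_number_eqI[OF g k] by simp
qed

section \<open>Homotopy classes\<close>

lemma adele_winding_number_eq:
  "adele_winding_number f = gen_winding_number (\<lambda>x. f (adele_class (x, rat_finite_adele 0)))"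
  by (simp add: adele_winding_number_def rat_finite_adele_0)

lemma continuous_map_circle_iff:
  "continuous_map X circle f \<longleftrightarrow>
     continuous_map X euclidean f \<and> (\<forall>x\<in>topspace X. norm (f x) = 1)"
  by (auto simp: continuous_map_in_subtopology Pi_iff)

lemma continuous_map_complex_divide:
  fixes f g :: "'a \<Rightarrow> complex"
  assumes "continuous_map X euclidean f" "continuous_map X euclidean g"
    and "\<And>x. x \<in> topspace X \<Longrightarrow> g x \<noteq> 0"
  shows "continuous_map X euclidean (\<lambda>x. f x / g x)"
  using assms by (simp add: continuous_map_atin tendsto_divide)

lemma continuous_map_complex_mult:
  fixes f g :: "'a \<Rightarrow> complex"
  assumes "continuous_map X euclidean f" "continuous_map X euclidean g"
  shows "continuous_map X euclidean (\<lambda>x. f x * g x)"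
  using assms by (simp add: continuous_map_atin tendsto_mult)

lemma continuous_map_circle_divide:
  assumes f: "continuous_map X circle f" and g: "continuous_map X circle g"
  shows "continuous_map X circle (\<lambda>x. f x / g x)"
proof -
  have "g x \<noteq> 0" if "x \<in> topspace X" for x
    using g that by (force simp: continuous_map_circle_iff)
  then show ?thesis
    using f g unfolding continuous_map_circle_iff
    by (auto intro!: continuous_map_complex_divide simp: norm_divide)
qed

lemma continuous_map_comp_continuous_on:
  assumes "continuous_map X euclidean f" "continuous_on S g" "\<And>x. x \<in> topspace X \<Longrightarrow> f x \<in> S"
  shows "continuous_map X euclidean (\<lambda>x. g (f x))"
proof -
  have "continuous_map X (top_of_set S) f"
    using assms(1,3) by (auto simp: continuous_map_in_subtopology)
  from continuous_map_compose[OF this, of euclidean g] assms(2) show ?thesis by (simp add: o_def)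
qed

lemma continuous_map_cis:
  assumes "continuous_map X euclideanreal f"
  shows "continuous_map X euclidean (\<lambda>x. cis (f x))"
  by (rule continuous_map_comp_continuous_on[OF assms, of UNIV]) (auto intro: continuous_intros)

lemma adele_winding_number_divide:
  assumes f: "continuous_map adele_class_topology circle f"
    and g: "continuous_map adele_class_topology circle g"
  shows "adele_winding_number (\<lambda>\<xi>. f \<xi> / g \<xi>) = adele_winding_number f - adele_winding_number g"
  unfolding adele_winding_number_eq
  using pre_periodic_adele_real_line[OF f] pre_periodic_adele_real_line[OF g]
    pre_periodic_adele_real_line[OF continuous_map_circle_divide[OF f g]]
  by (rule gen_winding_number_divide)

lemma adele_winding_number_near:
  assumes f: "continuous_map adele_class_topology circle f"
    and g: "continuous_map adele_class_topology circle g"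
    and near: "\<And>\<xi>. \<xi> \<in> topspace adele_class_topology \<Longrightarrow> norm (f \<xi> - g \<xi>) < 1"
  shows "adele_winding_number f = adele_winding_number g"
  unfolding adele_winding_number_eq
  using pre_periodic_adele_real_line[OF f] pre_periodic_adele_real_line[OF g]
  by (rule gen_winding_number_near) (simp add: near adele_class_in)

lemma homotopic_imp_adele_winding_number_eq:
  assumes "homotopic_with (\<lambda>h. True) adele_class_topology circle f g"
  shows "adele_winding_number f = adele_winding_number g"
proof -
  let ?X = "adele_class_topology" and ?I = "top_of_set {0..1::real}"
  obtain k where k: "continuous_map (prod_topology ?I ?X) circle k"
    and k0: "\<And>\<xi>. k (0, \<xi>) = f \<xi>" and k1: "\<And>\<xi>. k (1, \<xi>) = g \<xi>"
    using assms unfolding homotopic_with_def by blast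
  have ke: "continuous_map (prod_topology ?I ?X) euclidean k"
    using k by (simp add: continuous_map_circle_iff)
  have slice: "continuous_map ?X circle (\<lambda>\<xi>. k (t, \<xi>))" if "t \<in> {0..1}" for t
    using continuous_map_o_Pair[OF k, of t] that by (simp add: o_def)
  define w where "w t = adele_winding_number (\<lambda>\<xi>. k (t, \<xi>))" for t
  have "eventually (\<lambda>s. w t = w s) (at t within {0..1})" if t: "t \<in> {0..1}" for t
  proof -
    let ?d = "\<lambda>p. norm (k p - k (t, snd p))"
    have "continuous_map (prod_topology ?I ?X) euclidean (\<lambda>p. k (t, snd p))"
      using continuous_map_compose[OF continuous_map_snd[of ?I ?X], of euclidean "\<lambda>\<xi>. k (t, \<xi>)"] slice[OF t]
      by (simp add: o_def continuous_map_circle_iff)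
    then have "continuous_map (prod_topology ?I ?X) euclideanreal ?d"
      using ke by (simp add: continuous_map_atin tendsto_norm tendsto_diff)
    from openin_continuous_map_preimage[OF this, of "{..<1}"]
    have W: "openin (prod_topology ?I ?X) {p \<in> topspace (prod_topology ?I ?X). ?d p \<in> {..<1}}" by simp
    \<comment> \<open>Since A/Q is compact, the tube lemma yields a neighbourhood U of t whose
      slices are within 1 of the slice at t, uniformly on A/Q.\<close>
    have sub: "{t} \<times> topspace ?X \<subseteq> {p \<in> topspace (prod_topology ?I ?X). ?d p \<in> {..<1}}"
      using t by auto
    obtain U V where U: "openin ?I U" "t \<in> U" and V: "topspace ?X \<subseteq> V"
      and UV: "U \<times> V \<subseteq> {p \<in> topspace (prod_topology ?I ?X). ?d p \<in> {..<1}}"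
      using tube_lemma_right[OF W _ _ sub] t compact_space_adele_class_topology
      unfolding compact_space_def by (metis (no_types, lifting) topspace_euclidean_subtopology)
    have "w t = w s" if s: "s \<in> U" for s
    proof -
      have "s \<in> {0..1}" using openin_subset[OF U(1)] s by auto
      moreover have "norm (k (s, \<xi>) - k (t, \<xi>)) < 1" if "\<xi> \<in> topspace ?X" for \<xi>
      proof -
        have "(s, \<xi>) \<in> U \<times> V" using V s that by blast
        then show ?thesis using UV by auto
      qed
      ultimately have "w s = w t"
        unfolding w_def using t by (intro adele_winding_number_near slice) auto
      then show ?thesis by simp
    qed
    moreover obtain T where "open T" "U = {0..1} \<inter> T" using U(1) by (auto simp: openin_open)
    ultimately show ?thesis
      unfolding eventually_at_topological using U(2) by blast
  qed
  then have "w 0 = w 1"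
    by (intro connected_local_const[of "{0..1}"]) auto
  then show ?thesis by (simp add: w_def k0 k1)
qed

section \<open>From periodic functions on the line to a logarithm on A/Q\<close>

lemma periodic_extension:
  fixes v :: "real \<Rightarrow> real"
  assumes v: "continuous_on {0..T} v" "v 0 = v T" and T: "T > 0"
  obtains u where "continuous_on UNIV u" "\<And>x (k::int). u (x + of_int k * T) = u x"
    "\<And>x. x \<in> {0..T} \<Longrightarrow> u x = v x"
proof -
  define u where "u x = v (x - of_int \<lfloor>x / T\<rfloor> * T)" for x
  \<comment> \<open>The formula holds on the closed period: at its right end the floor jumps, and v
    0 = v T repairs the value.\<close>
  have u: "u x = v (x - of_int k * T)" if "x \<in> {of_int k * T..of_int (k + 1) * T}" for x and k :: int
  proof (cases "x = of_int (k + 1) * T")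
    case True
    then have "\<lfloor>x / T\<rfloor> = k + 1" using T by simp
    then show ?thesis using True v(2) by (simp add: u_def algebra_simps)
  next
    case False
    then have "of_int k \<le> x / T" "x / T < of_int k + 1" using that T by (auto simp: field_simps)
    then have "\<lfloor>x / T\<rfloor> = k" by (rule floor_unique)
    then show ?thesis by (simp add: u_def)
  qed
  have cont: "continuous_on {of_int k * T..of_int (k + 1) * T} u" for k :: int
  proof -
    have "continuous_on {of_int k * T..of_int (k + 1) * T} (\<lambda>x. v (x - of_int k * T))"
      by (rule continuous_on_compose2[OF v(1)]) (auto intro!: continuous_intros simp: algebra_simps)
    then show ?thesis by (rule continuous_on_eq) (simp add: u)
  qed
  have "isCont u x" for x
  proof -
    define k where "k = \<lfloor>x / T\<rfloor>"
    have "of_int k \<le> x / T" "x / T < of_int k + 1" unfolding k_def by linarith+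
    then have x: "of_int k * T \<le> x" "x < of_int (k + 1) * T"
      using T by (simp_all add: field_simps)
    \<comment> \<open>Two adjacent periods, since x may be the left end k T of its own period and
      has to be an interior point.\<close>
    let ?S = "{of_int (k - 1) * T..of_int (k - 1 + 1) * T} \<union> {of_int k * T..of_int (k + 1) * T}"
    have "continuous_on ?S u" by (intro continuous_on_closed_Un cont) auto
    moreover have "{of_int (k - 1) * T<..<of_int (k + 1) * T} \<subseteq> ?S" by auto
    ultimately have "continuous_on {of_int (k - 1) * T<..<of_int (k + 1) * T} u"
      using continuous_on_subset by blast
    moreover have "x \<in> {of_int (k - 1) * T<..<of_int (k + 1) * T}"
      using x T by (simp add: algebra_simps)
    ultimately show ?thesis by (simp add: continuous_on_eq_continuous_at)
  qed
  then have "continuous_on UNIV u" by (simp add: continuous_at_imp_continuous_on)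
  moreover have "u (x + of_int k * T) = u x" for x and k :: int
  proof -
    have "(x + of_int k * T) / T = x / T + of_int k" using T by (simp add: field_simps)
    then show ?thesis by (simp add: u_def algebra_simps)
  qed
  moreover have "u x = v x" if "x \<in> {0..T}" for x using u[of x 0] that by simp
  ultimately show ?thesis by (rule that)
qed

text \<open>The pullback of u along the projection from A/Q to R/NZ. It sends the class of (x, z) to
  x - q for any rational q in z + N Zhat; another choice of q changes this by a multiple of
  N.\<close>

lemma adele_class_function_of_periodic:
  fixes u :: "real \<Rightarrow> real"
  assumes u: "continuous_on UNIV u" "\<And>x (k::int). u (x + of_int k * of_nat N) = u x" and N: "N > 0"
  obtains \<psi> where "continuous_map adele_class_topology euclideanreal \<psi>"
    "\<And>x z q. z \<in> finite_adeles \<Longrightarrow> rat_finite_adele q \<in> finite_adele_nhd N z \<Longrightarrow>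
       \<psi> (adele_class (x, z)) = u (x - of_rat q)"
proof -
  have "\<exists>q. rat_finite_adele q \<in> finite_adele_nhd N z" if "z \<in> finite_adeles" for z
    using finite_adele_strong_approximation[OF N that] by blast
  then obtain Q where Q: "\<And>z. z \<in> finite_adeles \<Longrightarrow> rat_finite_adele (Q z) \<in> finite_adele_nhd N z"
    by metis
  define F where "F a = u (fst a - of_rat (Q (snd a)))" for a :: adele
  have F: "F (x, z) = u (x - of_rat q)"
    if z: "z \<in> finite_adeles" and q: "rat_finite_adele q \<in> finite_adele_nhd N z" for x z q
  proof -
    have "rat_finite_adele q \<in> finite_adele_nhd N (rat_finite_adele (Q z))"
      using finite_adele_nhd_trans[OF q finite_adele_nhd_sym[OF Q[OF z] z]] by simp
    then obtain k :: int where "q - Q z = of_int k * of_nat N"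
      using rat_finite_adele_nhd_iff[OF N] by blast
    then have "q = Q z + of_int k * of_nat N" by simp
    then have "x - of_rat (Q z) = x - of_rat q + of_int k * of_nat N"
      by (simp add: of_rat_add of_rat_mult)
    then show ?thesis using u(2)[of "x - of_rat q" k] by (simp only: F_def fst_conv snd_conv)
  qed
  have "continuous_map adele_topology euclideanreal F"
    unfolding continuous_map_eq_topcontinuous_at topcontinuous_at_def
  proof (intro ballI conjI allI impI)
    fix a V assume a: "a \<in> topspace adele_topology" and V: "openin euclideanreal V \<and> F a \<in> V"
    obtain x z where xz: "a = (x, z)" "z \<in> finite_adeles"
      using a by (auto simp: topspace_adele_topology_eq)
    \<comment> \<open>\<open>Q\<close> is an arbitrary choice and need not be continuous, but
      \<open>Q z\<close> approximates every w in this neighbourhood, so there F (y, w) can be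
      computed with this one fixed rational.\<close>
    let ?U = "{y. u (y - of_rat (Q z)) \<in> V} \<times> finite_adele_nhd N z"
    have "continuous_on UNIV (\<lambda>y. u (y - of_rat (Q z)))"
      by (rule continuous_on_compose2[OF u(1)]) (auto intro!: continuous_intros)
    then have "open {y. u (y - of_rat (Q z)) \<in> V}"
      using V open_vimage[of V "\<lambda>y. u (y - of_rat (Q z))"] by (simp add: vimage_def)
    then have "openin adele_topology ?U"
      unfolding adele_topology_def openin_prod_Times_iff
      using openin_finite_adele_nhd[OF N xz(2)] by simp
    moreover have "a \<in> ?U"
      using V finite_adele_nhd_self[OF xz(2)] by (simp add: xz(1) F_def)
    moreover have "F b \<in> V" if bU: "b \<in> ?U" for b
    proof -
      obtain y w where b: "b = (y, w)" "u (y - of_rat (Q z)) \<in> V" "w \<in> finite_adele_nhd N z"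
        using bU by auto
      have w: "w \<in> finite_adeles" using b(3) finite_adele_nhd_subset by blast
      have "rat_finite_adele (Q z) \<in> finite_adele_nhd N w"
        using finite_adele_nhd_trans[OF Q[OF xz(2)] finite_adele_nhd_sym[OF b(3) xz(2)] w] .
      then show ?thesis using b(2) F[OF w] by (simp add: b(1))
    qed
    ultimately show "\<exists>U. openin adele_topology U \<and> a \<in> U \<and> (\<forall>b\<in>U. F b \<in> V)" by blast
  qed auto
  moreover have "F a = F b"
    if a: "a \<in> topspace adele_topology" and b: "b \<in> topspace adele_topology"
      and eq: "adele_class a = adele_class b" for a b
  proof -
    obtain x z where az: "a = (x, z)" "z \<in> finite_adeles"
      using a by (auto simp: topspace_adele_topology_eq)
    obtain y w where bw: "b = (y, w)" "w \<in> finite_adeles"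
      using b by (auto simp: topspace_adele_topology_eq)
    obtain r where r: "y = x + of_rat r" "w = finite_adele_shift z r"
      using adele_class_eqE[OF eq[unfolded az bw] az(2) bw(2)] by blast
    \<comment> \<open>Translating z by r translates its approximation as well, and the real
      coordinate y = x + r compensates for it.\<close>
    have "rat_finite_adele (Q z + r) \<in> finite_adele_nhd N w"
      using finite_adele_nhd_shift[OF Q[OF az(2)] az(2), of r] by (simp add: r(2) finite_adele_shift_rat)
    from F[OF bw(2) this, of y] show ?thesis
      by (simp add: az(1) bw(1) F_def r(1) of_rat_add)
  qed
  ultimately obtain \<psi> where \<psi>: "continuous_map adele_class_topology euclideanreal \<psi>"
    "\<And>a. a \<in> topspace adele_topology \<Longrightarrow> \<psi> (adele_class a) = F a"
    using quotient_map_lift_exists[OF quotient_map_adele_class, of euclideanreal F] by metis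
  show ?thesis
  proof (rule that[OF \<psi>(1)])
    fix x z q assume "z \<in> finite_adeles" "rat_finite_adele q \<in> finite_adele_nhd N z"
    then show "\<psi> (adele_class (x, z)) = u (x - of_rat q)"
      using F by (simp add: \<psi>(2) topspace_adele_topology_eq)
  qed
qed

text \<open>A third of a turn is where the cosine reaches -1/2. The gap between -1/2 and -1 absorbs
  the error made in leaving the real line.\<close>

lemma cos_gt_minus_half:
  assumes "\<bar>t\<bar> < 1 / 3" shows "cos (2 * pi * t) > - 1 / 2"
proof -
  have "cos (2 * pi * \<bar>t\<bar>) > cos (2 * pi / 3)"
    using assms by (intro cos_monotone_0_pi) (auto simp: field_simps)
  moreover have "cos (2 * pi * \<bar>t\<bar>) = cos (2 * pi * t)" by (cases "t \<ge> 0") auto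
  ultimately show ?thesis by (simp add: cos_120)
qed

text \<open>
  A lift \<open>l\<close> of \<open>h\<close> on the real line is \<open>N\<close>-periodic up to \<open>1/6\<close> when the winding number
  vanishes; subtracting a small linear correction on \<open>[0,N]\<close> makes it exactly periodic, hence a
  function on \<open>\<bbbA>/\<rat>\<close>, at the cost of a factor that avoids \<open>-1\<close> and so has a continuous argument.
\<close>

lemma adele_winding_number_0_imp_lift:
  assumes h: "continuous_map adele_class_topology circle h" and w0: "adele_winding_number h = 0"
  obtains \<phi> where "continuous_map adele_class_topology euclideanreal \<phi>"
    "\<And>\<xi>. \<xi> \<in> topspace adele_class_topology \<Longrightarrow> h \<xi> = cis (2 * pi * \<phi> \<xi>)"
proof -
  let ?X = adele_class_topology
  have he: "continuous_map ?X euclidean h" and h1: "\<And>\<xi>. \<xi> \<in> topspace ?X \<Longrightarrow> norm (h \<xi>) = 1"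
    using h by (auto simp: continuous_map_circle_iff)
  define H where "H x = h (adele_class (x, rat_finite_adele 0))" for x
  have pp: "pre_periodic H" unfolding H_def by (rule pre_periodic_adele_real_line[OF h])
  obtain l where l: "circle_lift H l"
    using pp ex_circle_lift unfolding pre_periodic_def by blast
  then have lc: "continuous_on UNIV l" and Hl: "\<And>x. H x = cis (2 * pi * l x)"
    by (auto simp: circle_lift_iff_cis)
  \<comment> \<open>The error 1/8 is below the bound 1 needed for almost periods, and subtracted
    from the cosine bound -1/2 it still keeps the real part of \<rho> above -1.\<close>
  obtain N where N: "N > 0" and near: "\<And>x z y. z \<in> finite_adeles \<Longrightarrow> y \<in> finite_adele_nhd N z \<Longrightarrow>
       norm (h (adele_class (x, y)) - h (adele_class (x, z))) < 1 / 8"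
    using adele_function_uniform[OF he, of "1 / 8"] by auto
  have "norm (H (x + of_nat k * of_nat N) - H x) < 1" for k :: nat and x
    using adele_real_line_uniform_period[of N h "1 / 8" x "int k", OF near N] by (simp add: H_def)
  then obtain m :: int where
    m: "\<And>(k::nat) x. \<bar>l (x + of_nat k * of_nat N) - l x - of_nat k * of_int m\<bar> < 1 / 6"
      "mean_slope l (of_int m / of_nat N)"
    using circle_lift_almost_period[OF l N] by blast
  have "of_int m / of_nat N = (0::real)"
    using gen_winding_number_eqI[OF pp l m(2)] w0 unfolding adele_winding_number_eq H_def by simp
  then have "m = 0" using N by simp
  then have lk: "\<bar>l (x + of_nat k * of_nat N) - l x\<bar> < 1 / 6" for k :: nat and x
    using m(1)[of x k] by simp
  define c where "c = l (of_nat N) - l 0"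
  have c: "\<bar>c\<bar> < 1 / 6" using lk[of 0 1] by (simp add: c_def)
  define v where "v x = l x - c * (x / of_nat N)" for x
  have "continuous_on {0..real N} v"
    unfolding v_def by (intro continuous_intros continuous_on_subset[OF lc]) (use N in auto)
  moreover have "v 0 = v (real N)" using N by (simp add: v_def c_def)
  ultimately obtain u where u: "continuous_on UNIV u" "\<And>x (k::int). u (x + of_int k * of_nat N) = u x"
    and uv: "\<And>x. x \<in> {0..real N} \<Longrightarrow> u x = v x"
    using periodic_extension[of "real N" v] N by auto
  \<comment> \<open>Two errors below 1/6: moving y into [0,N] changes l by that little, and there
    the linear correction is at most |c|.\<close>
  have lu: "\<bar>l y - u y\<bar> < 1 / 3" for y
  proof -
    define k where "k = \<lfloor>y / real N\<rfloor>"
    define r where "r = y - of_int k * of_nat N"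
    have N': "real N > 0" using N by simp
    have "of_int k \<le> y / real N" "y / real N < of_int k + 1" unfolding k_def by linarith+
    then have r: "r \<in> {0..real N}"
      using N' by (simp add: r_def field_simps)
    have y: "y = r + of_int k * of_nat N" by (simp add: r_def)
    have "\<bar>c * (r / real N)\<bar> \<le> \<bar>c\<bar>"
      unfolding abs_mult using r N' by (intro mult_left_le) auto
    moreover have "l r - u y = c * (r / real N)" using uv[OF r] u(2)[of r k] by (simp add: y v_def)
    ultimately have "\<bar>l r - u y\<bar> < 1 / 6" using c by linarith
    moreover have "\<bar>l y - l r\<bar> < 1 / 6"
    proof (cases "k \<ge> 0")
      case True
      then have "y = r + of_nat (nat k) * of_nat N" by (simp add: r_def)
      then show ?thesis using lk by metis
    next
      case False
      then have "r = y + of_nat (nat (- k)) * of_nat N" by (simp add: r_def)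
      then have "\<bar>l r - l y\<bar> < 1 / 6" using lk by metis
      then show ?thesis by (simp add: abs_minus_commute)
    qed
    ultimately show ?thesis by linarith
  qed
  obtain \<psi> where \<psi>: "continuous_map ?X euclideanreal \<psi>"
    and \<psi>u: "\<And>x z q. z \<in> finite_adeles \<Longrightarrow> rat_finite_adele q \<in> finite_adele_nhd N z \<Longrightarrow>
       \<psi> (adele_class (x, z)) = u (x - of_rat q)"
    using adele_class_function_of_periodic[OF u N] by blast
  define \<rho> where "\<rho> \<xi> = h \<xi> / cis (2 * pi * \<psi> \<xi>)" for \<xi>
  have \<rho>c: "continuous_map ?X euclidean \<rho>"
    unfolding \<rho>_def
    by (intro continuous_map_complex_divide he continuous_map_cis continuous_map_real_mult_left \<psi>) simp
  have \<rho>1: "norm (\<rho> \<xi>) = 1" if "\<xi> \<in> topspace ?X" for \<xi>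
    using h1[OF that] by (simp add: \<rho>_def norm_divide)
  have \<rho>Re: "Re (\<rho> \<xi>) > - 1" if \<xi>: "\<xi> \<in> topspace ?X" for \<xi>
  proof -
    obtain x z where z: "z \<in> finite_adeles" and \<xi>: "\<xi> = adele_class (x, z)"
      using \<xi> unfolding topspace_adele_class_topology by auto
    obtain q where q: "rat_finite_adele q \<in> finite_adele_nhd N z"
      using finite_adele_strong_approximation[OF N z] by blast
    define y where "y = x - of_rat q"
    have "adele_class (x, rat_finite_adele q) = adele_class (y, rat_finite_adele 0)"
      using adele_class_shift[of "rat_finite_adele q" x "- q"]
      by (simp add: finite_adele_shift_rat y_def of_rat_minus)
    then have "norm (H y - h \<xi>) < 1 / 8" using near[OF z q, of x] by (simp add: H_def \<xi>)
    \<comment> \<open>On the real line h is given exactly by l. The last term is the price of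
      replacing (x, z) by (x, q), which is the translate of (y, 0).\<close>
    moreover have "\<rho> \<xi> = cis (2 * pi * (l y - u y)) - (H y - h \<xi>) / cis (2 * pi * u y)"
      using \<psi>u[OF z q, of x]
      by (simp add: \<rho>_def \<xi> y_def Hl diff_divide_distrib cis_divide right_diff_distrib)
    moreover have "Re ((H y - h \<xi>) / cis (2 * pi * u y)) \<le> norm (H y - h \<xi>)"
      using complex_Re_le_cmod[of "(H y - h \<xi>) / cis (2 * pi * u y)"] by (simp add: norm_divide)
    moreover have "cos (2 * pi * (l y - u y)) > - 1 / 2" by (rule cos_gt_minus_half[OF lu])
    ultimately show ?thesis by simp
  qed
  \<comment> \<open>The nonpositive real axis meets the unit circle only in -1, which the bound on
    the real part excludes; so the principal argument is continuous along \<rho>.\<close>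
  have \<rho>N: "\<rho> \<xi> \<in> - \<real>\<^sub>\<le>\<^sub>0" if \<xi>: "\<xi> \<in> topspace ?X" for \<xi>
  proof -
    have False if "\<rho> \<xi> = of_real r" "r \<le> 0" for r
      using \<rho>1[OF \<xi>] \<rho>Re[OF \<xi>] that by simp
    then show ?thesis by (auto elim!: nonpos_Reals_cases)
  qed
  define \<phi> where "\<phi> \<xi> = \<psi> \<xi> + 1 / (2 * pi) * Arg (\<rho> \<xi>)" for \<xi>
  have "continuous_map ?X euclideanreal \<phi>"
    unfolding \<phi>_def
    by (intro continuous_map_add \<psi> continuous_map_real_mult_left
        continuous_map_comp_continuous_on[OF \<rho>c continuous_on_Arg \<rho>N])
  moreover have "h \<xi> = cis (2 * pi * \<phi> \<xi>)" if \<xi>: "\<xi> \<in> topspace ?X" for \<xi>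
  proof -
    have "\<rho> \<xi> \<noteq> 0" using \<rho>1[OF \<xi>] by auto
    then have "cis (Arg (\<rho> \<xi>)) = \<rho> \<xi>"
      using \<rho>1[OF \<xi>] by (simp add: cis_Arg sgn_div_norm)
    moreover have "2 * pi * \<phi> \<xi> = 2 * pi * \<psi> \<xi> + Arg (\<rho> \<xi>)"
      by (simp add: \<phi>_def algebra_simps)
    ultimately have "cis (2 * pi * \<phi> \<xi>) = cis (2 * pi * \<psi> \<xi>) * \<rho> \<xi>"
      by (simp add: cis_mult[symmetric])
    then show ?thesis by (simp add: \<rho>_def)
  qed
  ultimately show ?thesis by (rule that)
qed

lemma adele_winding_number_eq_imp_homotopic:
  assumes f: "continuous_map adele_class_topology circle f"
    and g: "continuous_map adele_class_topology circle g"
    and eq: "adele_winding_number f = adele_winding_number g"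
  shows "homotopic_with (\<lambda>h. True) adele_class_topology circle f g"
proof -
  let ?X = adele_class_topology and ?I = "top_of_set {0..1::real}"
  have f1: "norm (f \<xi>) = 1" and g1: "norm (g \<xi>) = 1" if "\<xi> \<in> topspace ?X" for \<xi>
    using f g that by (auto simp: continuous_map_circle_iff)
  have "adele_winding_number (\<lambda>\<xi>. g \<xi> / f \<xi>) = 0"
    using adele_winding_number_divide[OF g f] eq by simp
  then obtain \<phi> where \<phi>: "continuous_map ?X euclideanreal \<phi>"
    "\<And>\<xi>. \<xi> \<in> topspace ?X \<Longrightarrow> g \<xi> / f \<xi> = cis (2 * pi * \<phi> \<xi>)"
    using adele_winding_number_0_imp_lift[OF continuous_map_circle_divide[OF g f]] by blast
  define k where "k p = f (snd p) * cis (2 * pi * (fst p * \<phi> (snd p)))" for p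
  have fst: "continuous_map (prod_topology ?I ?X) euclideanreal fst"
    by (rule continuous_map_into_fulltopology[OF continuous_map_fst])
  have snd: "continuous_map (prod_topology ?I ?X) T (\<lambda>p. j (snd p))"
    if "continuous_map ?X T j" for T and j :: "adele set \<Rightarrow> 'b"
    using continuous_map_compose[OF continuous_map_snd that] by (simp add: o_def)
  have "continuous_map (prod_topology ?I ?X) euclidean k"
    unfolding k_def using f
    by (intro continuous_map_complex_mult continuous_map_cis continuous_map_real_mult_left
        continuous_map_real_mult fst snd \<phi>) (simp add: continuous_map_circle_iff)
  then have "continuous_map (prod_topology ?I ?X) circle k"
    unfolding continuous_map_circle_iff using f1 by (auto simp: k_def norm_mult)
  moreover have "k (0, \<xi>) = f \<xi>" "k (1, \<xi>) = g \<xi>" if "\<xi> \<in> topspace ?X" for \<xi>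
    using \<phi>(2)[OF that, symmetric] f1[OF that] by (auto simp: k_def)
  \<comment> \<open>Outside the space A/Q the functions take arbitrary values, so the end slices are
    compared with f and g only on the space itself.\<close>
  ultimately show ?thesis
    by (subst homotopic_with) auto
qed

theorem mainTheorem4:
  fixes f g :: "adele set \<Rightarrow> complex"
  assumes "continuous_map adele_class_topology circle f"
    and "continuous_map adele_class_topology circle g"
  shows "homotopic_with (\<lambda>h. True) adele_class_topology circle f g \<longleftrightarrow>
         adele_winding_number f = adele_winding_number g"
  using homotopic_imp_adele_winding_number_eq adele_winding_number_eq_imp_homotopic[OF assms] by blast

end
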